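(* Suppose the arrival rate is constant, $\lambda(t)=\lambda>0$, and that for each $j\in\{1,\dots,J\}$ there exists $\delta_j>0$ such that $Q_j(\tau)=\Theta(e^{-\delta_j\tau})$ as $\tau\to\infty$. Then the network is ergodic if and only if $\mathbb{E}[\log(S_1+\dots+S_J+1)]<\infty$.
   Context: Consider an open network of $J$ infinite server queues, indexed $1,\dots,J$, empty at time $0$. Batches arrive at the points $T_1,T_2,\dots$ of a homogeneous Poisson process on $[0,\infty)$ with rate $\lambda>0$. At time $T_i$, $\Sigma_{ij}$ customers arrive at queue $j$, for $j=1,\dots,J$. The vectors $\mathbf{\Sigma}_i=(\Sigma_{i1},\dots,\Sigma_{iJ})$, with non-negative integer components, are i.i.d. (and independent of the arrival times), with the same distribution as a generic vector $\mathbf{S}=(S_1,\dots,S_J)$. The $\ell$th customer entering queue $j$ at time $T_i$ carries a stochastic process $X^j_{i,\ell}(t)$, $t\ge 0$, where $X^j_{i,\ell}(t)=k\in\{1,\dots,J\}$ means that the customer is in queue $k$ at time $T_i+t$ (and $X^j_{i,\ell}(t)\notin\{1,\dots,J\}$ if the customer has left the network; customers that have left do not return). These processes are mutually independent and independent of the arrival times and batch sizes (conditionally on the node of entry), with $P(X^j_{i,\ell}(t)=k)=q^j_k(t)$ (measurable in $t$). Put $Q_j(t)=\sum_{k=1}^J q^j_k(t)$, the probability that a customer who entered at queue $j$ is still in the network a time $t$ after arrival. $\mathbf{N}(t)=(N_1(t),\dots,N_J(t))$ is the vector of numbers of customers in each queue at time $t$. The network is called ergodic if, as $t\to\infty$,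 $\mathbf{N}(t)$ converges in distribution to a proper probability distribution on $\mathbb{Z}_{\ge 0}^J$. The notation $f(\tau)=\Theta(g(\tau))$ as $\tau\to\infty$ means that there are constants $0<c\le c'$ with $c\,g(\tau)\le f(\tau)\le c'g(\tau)$ for all sufficiently large $\tau$. *)

theory Defs
  imports "HOL-Probability.Probability" "HOL-Library.Landau_Symbols"
begin

text \<open>
  The queues are the elements of a finite type \<open>'j\<close> (so \<open>J = CARD('j)\<close>), and a vector of numbers
  indexed by the queues has type \<open>nat ^ 'j\<close>. Batches, and the customers of a batch that enter at
  the same queue, are numbered from \<open>0\<close>. The location of a customer is \<open>Some k\<close> in queue \<open>k\<close>, and
  \<open>None\<close> outside the network.
\<close>

section \<open>Arrival times\<close>

definition gap :: "(nat \<Rightarrow> 'a \<Rightarrow> real) \<Rightarrow> nat \<Rightarrow> 'a \<Rightarrow> real" where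
  "gap T i \<omega> = (if i = 0 then T 0 \<omega> else T i \<omega> - T (i - 1) \<omega>)"

definition poisson_points :: "'a measure \<Rightarrow> real \<Rightarrow> (nat \<Rightarrow> 'a \<Rightarrow> real) \<Rightarrow> bool" where
  "poisson_points M rate T \<longleftrightarrow>
     prob_space.indep_vars M (\<lambda>_. borel) (gap T) UNIV \<and>
     (\<forall>i. distributed M lborel (gap T i) (exponential_density rate))"


section \<open>The network\<close>

text \<open>The independent sources of randomness: the sequence of all arrival times, the vector of batch
  sizes of each batch, and the movements of each customer.\<close>

datatype 'j source = Arrivals | Batch nat | Customer nat 'j nat

definition source_events ::
  "'a measure \<Rightarrow> (nat \<Rightarrow> 'a \<Rightarrow> real) \<Rightarrow> (nat \<Rightarrow> 'a \<Rightarrow> nat ^ 'j) \<Rightarrow>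
   (nat \<Rightarrow> 'j \<Rightarrow> nat \<Rightarrow> 'a measure) \<Rightarrow> 'j source \<Rightarrow> 'a set set" where
  "source_events M T S F s =
     (case s of
        Arrivals \<Rightarrow> sets (vimage_algebra (space M) (\<lambda>\<omega> i. T i \<omega>) (Pi\<^sub>M UNIV (\<lambda>_. borel)))
      | Batch i \<Rightarrow> sets (vimage_algebra (space M) (S i) (count_space UNIV))
      | Customer i j l \<Rightarrow> sets (F i j l))"

text \<open>
  \<open>S i \<omega> $ j\<close> is the number of customers of batch \<open>i\<close> entering at queue \<open>j\<close>, and \<open>X i j l t \<omega>\<close> is the
  location of the \<open>l\<close>-th of them at time \<open>T i \<omega> + t\<close>. The processes \<open>X i j l\<close> are given for all \<open>l\<close>;
  only those with \<open>l < S i \<omega> $ j\<close> belong to actual customers.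

  The process of a customer is evaluated at the random time \<open>t - T i\<close>. For this to be a random
  variable \<open>X i j l\<close> has to be a measurable process, and independence of the \<open>\<sigma>\<close>-algebra generated
  by the coordinates \<open>X i j l s\<close> would not be enough: a process that equals \<open>Some k\<close> just at the
  time \<open>s = c - T i\<close> is jointly measurable and, \<open>T i\<close> having no atoms, its coordinates are almost
  surely constant, hence independent of \<open>T i\<close>. Independence of measurable processes is therefore
  expressed by \<open>\<sigma>\<close>-algebras \<open>F i j l\<close>, independent of each other and of arrival times and batch
  sizes, with respect to which the processes are jointly measurable in time and outcome.
\<close>

locale infinite_server_network = prob_space M for M :: "'a measure" +
  fixes rate :: real
    and T :: "nat \<Rightarrow> 'a \<Rightarrow> real"
    and p :: "(nat ^ 'j::finite) pmf"
    and S :: "nat \<Rightarrow> 'a \<Rightarrow> nat ^ 'j"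
    and X :: "nat \<Rightarrow> 'j \<Rightarrow> nat \<Rightarrow> real \<Rightarrow> 'a \<Rightarrow> 'j option"
    and q :: "'j \<Rightarrow> 'j \<Rightarrow> real \<Rightarrow> real"
  assumes rate_pos: "rate > 0"
    and arrivals: "poisson_points M rate T"
    and batch_measurable: "\<And>i. S i \<in> measurable M (count_space UNIV)"
    and batch_distr: "\<And>i. distr M (count_space UNIV) (S i) = measure_pmf p"
    and independent_sources:
      "\<exists>F. (\<forall>i j l. subalgebra M (F i j l) \<and>
                (\<lambda>(t, \<omega>). X i j l t \<omega>) \<in>
                  measurable (restrict_space borel {0..} \<Otimes>\<^sub>M F i j l) (count_space UNIV)) \<and>
           indep_sets (source_events M T S F) UNIV"
    and location_prob:
      "\<And>i j l k t. t \<ge> 0 \<Longrightarrow> prob {\<omega> \<in> space M. X i j l t \<omega> = Some k} = q j k t"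
    and location_prob_measurable:
      "\<And>j k. q j k \<in> borel_measurable (restrict_space borel {0..})"
    and no_return:
      "\<And>i j l. AE \<omega> in M. \<forall>s t. 0 \<le> s \<longrightarrow> s \<le> t \<longrightarrow> X i j l s \<omega> = None \<longrightarrow> X i j l t \<omega> = None"

definition in_network_prob :: "('j::finite \<Rightarrow> 'j \<Rightarrow> real \<Rightarrow> real) \<Rightarrow> 'j \<Rightarrow> real \<Rightarrow> real" where
  "in_network_prob q j t = (\<Sum>k\<in>UNIV. q j k t)"

definition queue_lengths ::
  "(nat \<Rightarrow> 'a \<Rightarrow> real) \<Rightarrow> (nat \<Rightarrow> 'a \<Rightarrow> nat ^ 'j) \<Rightarrow>
   (nat \<Rightarrow> 'j \<Rightarrow> nat \<Rightarrow> real \<Rightarrow> 'a \<Rightarrow> 'j option) \<Rightarrow> real \<Rightarrow> 'a \<Rightarrow> nat ^ 'j::finite" where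
  "queue_lengths T S X t \<omega> =
     (\<chi> k. card {(i, j, l). T i \<omega> \<le> t \<and> l < S i \<omega> $ j \<and> X i j l (t - T i \<omega>) \<omega> = Some k})"


section \<open>Ergodicity\<close>

definition converges_weakly ::
  "('t \<Rightarrow> 'b::topological_space measure) \<Rightarrow> 'b measure \<Rightarrow> 't filter \<Rightarrow> bool" where
  "converges_weakly \<mu>s \<mu> A \<longleftrightarrow>
     (\<forall>f :: 'b \<Rightarrow> real. continuous_on UNIV f \<longrightarrow> bounded (range f) \<longrightarrow>
        ((\<lambda>t. integral\<^sup>L (\<mu>s t) f) \<longlongrightarrow> integral\<^sup>L \<mu> f) A)"

definition ergodic :: "'a measure \<Rightarrow> (real \<Rightarrow> 'a \<Rightarrow> nat ^ 'j::finite) \<Rightarrow> bool" where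
  "ergodic M N \<longleftrightarrow>
     (\<exists>\<pi>. prob_space \<pi> \<and> sets \<pi> = sets borel \<and>
          converges_weakly (\<lambda>t. distr M borel (N t)) \<pi> at_top)"

end

theory Submission
  imports Defs
begin

text \<open>
  Let \<open>b u\<close>, called \<open>occupation u\<close> below, be the probability that some customer of a batch is still in
  the network at age \<open>u\<close>. The theorem splits into two equivalences through the condition that \<open>b\<close> is
  integrable at infinity.

  This condition means \<open>E (ln (n + 1)) < \<infinity>\<close>, \<open>n\<close> being the size of a batch. Indeed a customer is
  present at age \<open>u\<close> with a probability of exponential order, so a batch of \<open>n\<close> customers remains
  visible for a time of order \<open>ln (n + 1)\<close>; Tonelli's theorem turns this into the statement about
  expectations (\<open>occupation_integral_finite_iff_log_moment\<close>).

  That ergodicity is equivalent to the integrability of \<open>b\<close> could be seen from the fact that the batches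
  visible at time \<open>t\<close> are Poisson in number, with mean \<open>rate\<close> times the integral of \<open>b\<close> over \<open>{0..t}\<close>. The
  proof avoids the theory of marked Poisson processes and works with the expectation \<open>\<phi> t\<close> of \<open>f (N t)\<close>, for a
  bounded function \<open>f\<close> of the queue lengths \<open>N t\<close>. Let \<open>\<psi> t\<close> be the corresponding expectation when one
  more batch arrives at time \<open>0\<close>. Conditioning on the first arrival gives a renewal equation
  (\<open>renewal_equation\<close>), from which \<open>\<phi>' = rate * (\<psi> - \<phi>)\<close> follows in integrated form
  (\<open>mean_value_increment\<close>). The effect \<open>\<psi> - \<phi>\<close> of one additional batch is understood through
  \<open>extra_batch\<close>: batches are independent and identically distributed given their ages, so the
  additional one contributes an independent summand, which is nonzero with probability \<open>b t\<close>.

  If \<open>b\<close> is integrable, then \<open>\<bar>\<psi> - \<phi>\<bar> \<le> 2 * b\<close> for all \<open>\<bar>f\<bar> \<le> 1\<close> makes the laws of the queue lengths a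
  Cauchy family in total variation, and these converge
  (\<open>pmf_limit_of_total_variation_Cauchy\<close>). Conversely, let \<open>f\<close> be \<open>1 / 2\<close> to the power of the total number
  of customers. An additional visible batch at least halves it, so \<open>\<phi>' \<le> - rate * b * \<phi> / 2\<close>. If the
  network is ergodic, then \<open>\<phi>\<close> converges to a positive limit, which forces \<open>b\<close> to be integrable.
\<close>

section \<open>Integral equations and integrals over half-lines\<close>

lemma set_integrable_bounded_interval:
  fixes f :: "real \<Rightarrow> real"
  assumes [measurable]: "f \<in> borel_measurable borel" and "\<And>u. \<bar>f u\<bar> \<le> K"
  shows "set_integrable lborel {a..b} f"
  unfolding set_integrable_def
proof (rule integrableI_bounded_set_indicator[where B=K])
  show "emeasure lborel {a..b} < \<infinity>"
    by (cases "a \<le> b") auto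
qed (use assms in auto)

text \<open>
  The hypothesis says that \<open>exp (l * t) * \<phi> t\<close> is an antiderivative of \<open>l * exp (l * t) * \<psi> t\<close>, so that
  \<open>\<phi>' = l * (\<psi> - \<phi>)\<close>. Since \<open>\<psi>\<close> is merely measurable, this differential equation holds only almost
  everywhere. Its integrated form is therefore obtained without differentiation, by integrating the
  hypothesis over \<open>{0..t}\<close> and exchanging the two integrals.
\<close>

lemma renewal_imp_integral_equation:
  fixes \<phi> \<psi> :: "real \<Rightarrow> real"
  assumes l: "l > 0" and [measurable]: "\<psi> \<in> borel_measurable borel" "\<phi> \<in> borel_measurable borel"
    and bd: "\<And>u. \<bar>\<psi> u\<bar> \<le> C" "\<And>u. \<bar>\<phi> u\<bar> \<le> C"
    and ren: "\<And>t. t \<ge> 0 \<Longrightarrow> \<phi> t = exp (- l * t) * c + (LBINT u:{0..t}. l * exp (- l * (t - u)) * \<psi> u)"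
    and st: "0 \<le> s" "s \<le> t"
  shows "\<phi> t - \<phi> s = l * (LBINT u:{s..t}. \<psi> u - \<phi> u)"
proof -
  have C: "C \<ge> 0" using bd(1)[of 0] by linarith
  have main: "l * (LBINT v:{0..t}. \<phi> v) = c + l * (LBINT u:{0..t}. \<psi> u) - \<phi> t" if t: "t \<ge> 0" for t
  proof -
    \<comment> \<open>the integrand of the double integral over the triangle \<open>0 \<le> u \<le> v \<le> t\<close>\<close>
    define k where "k v u = (if 0 \<le> u \<and> u \<le> v \<and> v \<le> t then l * exp (- l * (v - u)) * \<psi> u else 0)" for v u
    have meas: "case_prod k \<in> borel_measurable (lborel \<Otimes>\<^sub>M lborel)"
      unfolding k_def by measurable
    have kb: "\<bar>k v u\<bar> \<le> l * C * indicator ({0..t} \<times> {0..t}) (v, u)" for v u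
    proof (cases "0 \<le> u \<and> u \<le> v \<and> v \<le> t")
      case True
      have "exp (- l * (v - u)) * \<bar>\<psi> u\<bar> \<le> 1 * C"
        using True l C bd(1)[of u] by (intro mult_mono) auto
      then show ?thesis using True l by (simp add: k_def abs_mult)
    qed (use l C in \<open>auto simp: k_def\<close>)
    have fin: "emeasure (lborel \<Otimes>\<^sub>M lborel) ({0..t} \<times> {0..t::real}) < \<infinity>"
      using t by (subst lborel.emeasure_pair_measure_Times) (auto simp: ennreal_mult_less_top)
    have kint: "integrable (lborel \<Otimes>\<^sub>M lborel) (case_prod k)"
    proof (rule Bochner_Integration.integrable_bound)
      show "integrable (lborel \<Otimes>\<^sub>M lborel) (\<lambda>x. l * C * indicator ({0..t} \<times> {0..t}) x :: real)"
        using fin by (intro integrable_mult_right integrable_real_indicator) auto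
      show "AE x in lborel \<Otimes>\<^sub>M lborel. norm (case_prod k x) \<le> norm (l * C * indicator ({0..t} \<times> {0..t}) x :: real)"
        using kb order_trans[OF kb abs_ge_self] by (intro always_eventually allI) auto
    qed (rule meas)
    have e1: "(LBINT v. indicator {a..t} v * (l * exp (- l * (v - a)))) = 1 - exp (- l * (t - a))" if "a \<le> t" for a
    proof -
      have "(LBINT v. (l * exp (- l * (v - a))) * indicator {a..t} v) = (- exp (- l * (t - a))) - (- exp (- l * (a - a)))"
        by (rule integral_FTC_Icc_real[OF that]) (auto intro!: derivative_eq_intros continuous_intros)
      then show ?thesis by (simp add: mult.commute)
    qed
    define I where "I = (LBINT v. LBINT u. k v u)"
    define P where "P = (LBINT u:{0..t}. l * exp (- l * (t - u)) * \<psi> u)"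
    have 1: "l * (LBINT v:{0..t}. \<phi> v) = c * (1 - exp (- l * t)) + l * I"
    proof -
      have "\<phi> v = exp (- l * v) * c + (LBINT u. k v u)" if "v \<in> {0..t}" for v
      proof -
        have "(LBINT u:{0..v}. l * exp (- l * (v - u)) * \<psi> u) = (LBINT u. k v u)"
          unfolding set_lebesgue_integral_def
          by (rule Bochner_Integration.integral_cong) (use that in \<open>auto simp: k_def indicator_def\<close>)
        then show ?thesis using ren[of v] that by simp
      qed
      moreover have "(LBINT u. k v u) = 0" if "v \<notin> {0..t}" for v
        using that by (intro integral_eq_zero_AE) (auto simp: k_def)
      ultimately have "l * (LBINT v:{0..t}. \<phi> v) = l * (LBINT v. indicator {0..t} v * exp (- l * v) * c + (LBINT u. k v u))"
        unfolding set_lebesgue_integral_def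
        by (intro arg_cong[where f="(*) l"] Bochner_Integration.integral_cong) (auto simp: indicator_def)
      also have "\<dots> = l * ((LBINT v. indicator {0..t} v * exp (- l * v) * c) + I)"
        unfolding I_def
      proof (subst Bochner_Integration.integral_add)
        show "integrable lborel (\<lambda>v. indicator {0..t} v * exp (- l * v) * c)"
        proof -
          have "continuous_on {0..t} (\<lambda>v. exp (- l * v) * c)" by (intro continuous_intros)
          from borel_integrable_atLeastAtMost'[OF this] show ?thesis
            by (simp add: set_integrable_def mult.assoc)
        qed
        show "integrable lborel (\<lambda>v. LBINT u. k v u)"
          using lborel_pair.integrable_fst'[OF kint] by simp
      qed simp
      also have "l * (LBINT v. indicator {0..t} v * exp (- l * v) * c) = c * (LBINT v. indicator {0..t} v * (l * exp (- l * (v - 0))))"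
        by (subst (1 2) integral_mult_right_zero[symmetric]) (simp add: mult_ac)
      then have "l * ((LBINT v. indicator {0..t} v * exp (- l * v) * c) + I) = c * (1 - exp (- l * t)) + l * I"
        using e1[OF t] by (simp add: distrib_left)
      finally show ?thesis .
    qed
    have 2: "I = (LBINT u. LBINT v. k v u)"
      unfolding I_def by (rule lborel_pair.Fubini_integral[symmetric]) (use kint in \<open>simp add: case_prod_unfold\<close>)
    have 3: "l * I = l * (LBINT u:{0..t}. \<psi> u) - P"
    proof -
      have in_u: "l * (LBINT v. k v u) = l * (indicator {0..t} u * \<psi> u) - indicator {0..t} u * (l * exp (- l * (t - u)) * \<psi> u)" for u
      proof (cases "0 \<le> u \<and> u \<le> t")
        case True
        have "(LBINT v. k v u) = (LBINT v. \<psi> u * (indicator {u..t} v * (l * exp (- l * (v - u)))))"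
          by (rule Bochner_Integration.integral_cong) (use True in \<open>auto simp: indicator_def k_def\<close>)
        also have "\<dots> = \<psi> u * (1 - exp (- l * (t - u)))"
          using e1[of u] True by simp
        finally have k_eq: "(LBINT v. k v u) = \<psi> u * (1 - exp (- l * (t - u)))" .
        show ?thesis unfolding k_eq using True by (simp add: algebra_simps)
      next
        case False
        then have "k v u = 0" for v by (auto simp: k_def)
        then show ?thesis using False by (auto simp: indicator_def)
      qed
      have i1: "integrable lborel (\<lambda>u. l * (indicator {0..t} u * \<psi> u))"
        using set_integrable_bounded_interval[of \<psi> C 0 t] bd by (simp add: set_integrable_def)
      have "exp (- l * (t - u)) * \<bar>\<psi> u\<bar> \<le> 1 * C" if "u \<le> t" for u
        using bd(1)[of u] l C that by (intro mult_mono) auto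
      then have "\<bar>if u \<le> t then l * exp (- l * (t - u)) * \<psi> u else 0\<bar> \<le> l * C" for u
        using l C by (auto simp: abs_mult mult.assoc)
      then have "set_integrable lborel {0..t} (\<lambda>u. if u \<le> t then l * exp (- l * (t - u)) * \<psi> u else 0)"
        by (intro set_integrable_bounded_interval[where K="l * C"]) auto
      also have "set_integrable lborel {0..t} (\<lambda>u. if u \<le> t then l * exp (- l * (t - u)) * \<psi> u else 0)
          \<longleftrightarrow> integrable lborel (\<lambda>u. indicator {0..t} u * (l * exp (- l * (t - u)) * \<psi> u))"
        unfolding set_integrable_def
        by (rule Bochner_Integration.integrable_cong) (auto simp: indicator_def)
      finally have i2: "integrable lborel (\<lambda>u. indicator {0..t} u * (l * exp (- l * (t - u)) * \<psi> u))" .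
      have "l * I = (LBINT u. l * (LBINT v. k v u))" unfolding 2 by simp
      also have "\<dots> = (LBINT u. l * (indicator {0..t} u * \<psi> u)) - (LBINT u. indicator {0..t} u * (l * exp (- l * (t - u)) * \<psi> u))"
        unfolding in_u by (rule Bochner_Integration.integral_diff[OF i1 i2])
      finally show ?thesis by (simp add: set_lebesgue_integral_def P_def)
    qed
    show ?thesis
      using 1 3 ren[OF t, folded P_def] by (simp add: algebra_simps)
  qed
  have split: "(LBINT u:{0..t}. f u) = (LBINT u:{0..s}. f u) + (LBINT u:{s..t}. f u)"
    if f[measurable]: "f \<in> borel_measurable borel" and "\<And>u. \<bar>f u\<bar> \<le> C" for f
  proof -
    have "(LBINT u:{0..t}. f u) = (LBINT u:{0..s} \<union> {s..t}. f u)" using st by (simp add: ivl_disj_un_two_touch)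
    also have "\<dots> = (LBINT u:{0..s}. f u) + (LBINT u:{s..t}. f u)"
    proof (rule set_integral_Un_AE)
      show "AE x in lborel. \<not> (x \<in> {0..s} \<and> x \<in> {s..t})"
        by (rule AE_I'[of "{s}"]) auto
    qed (use set_integrable_bounded_interval[OF that] in auto)
    finally show ?thesis .
  qed
  have "(LBINT u:{s..t}. \<psi> u - \<phi> u) = (LBINT u:{s..t}. \<psi> u) - (LBINT u:{s..t}. \<phi> u)"
    by (rule set_integral_diff) (rule set_integrable_bounded_interval; use bd in auto)+
  then have "l * (LBINT u:{s..t}. \<psi> u - \<phi> u) = l * (LBINT u:{s..t}. \<psi> u) - l * (LBINT u:{s..t}. \<phi> u)"
    by (simp add: right_diff_distrib)
  moreover have "l * (LBINT u:{0..t}. \<phi> u) = l * (LBINT u:{0..s}. \<phi> u) + l * (LBINT u:{s..t}. \<phi> u)"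
    "l * (LBINT u:{0..t}. \<psi> u) = l * (LBINT u:{0..s}. \<psi> u) + l * (LBINT u:{s..t}. \<psi> u)"
    using split[of \<phi>] split[of \<psi>] bd by (simp_all add: distrib_left)
  ultimately show ?thesis
    using main[of t] main[of s] st by linarith
qed

lemma integral_tail_small:
  fixes b :: "real \<Rightarrow> real"
  assumes [measurable]: "b \<in> borel_measurable borel" and nn: "\<And>u. b u \<ge> 0"
    and fin: "(\<integral>\<^sup>+u\<in>{\<tau>..}. ennreal (b u) \<partial>lborel) < \<infinity>" and e: "\<epsilon> > 0"
  shows "\<exists>s\<ge>\<tau>. \<forall>t. (LBINT u:{s..t}. b u) \<le> \<epsilon>"
proof -
  define h where "h u = indicator {\<tau>..} u * b u" for u
  have h0: "h u \<ge> 0" for u using nn by (simp add: h_def)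
  have hm[measurable]: "h \<in> borel_measurable borel" unfolding h_def[abs_def] by measurable
  have hi: "integrable lborel h"
  proof (rule integrableI_nonneg)
    have "(\<integral>\<^sup>+u. ennreal (h u) \<partial>lborel) = (\<integral>\<^sup>+u\<in>{\<tau>..}. ennreal (b u) \<partial>lborel)"
      by (rule nn_integral_cong) (simp add: h_def indicator_def)
    then show "(\<integral>\<^sup>+u. ennreal (h u) \<partial>lborel) < \<infinity>" using fin by simp
  qed (simp_all add: h0)
  have "(\<lambda>n. \<integral>u. indicator {real n..} u * h u \<partial>lborel) \<longlonglongrightarrow> (\<integral>u. (0::real) \<partial>(lborel :: real measure))"
  proof (rule integral_dominated_convergence[where w=h])
    show "AE u in lborel. (\<lambda>n. indicator {real n..} u * h u) \<longlonglongrightarrow> 0"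
    proof (rule AE_I2)
      fix u :: real
      obtain n0 :: nat where "u < real n0" using reals_Archimedean2 by blast
      then have "\<forall>n\<ge>n0. 0 = indicator {real n..} u * h u" by (auto simp: indicator_def)
      then have "eventually (\<lambda>n. 0 = indicator {real n..} u * h u) sequentially"
        unfolding eventually_sequentially by blast
      then show "(\<lambda>n. indicator {real n..} u * h u) \<longlonglongrightarrow> 0"
        by (rule Lim_transform_eventually[OF tendsto_const])
    qed
    show "AE u in lborel. norm (indicator {real n..} u * h u) \<le> h u" for n
      using h0 by (auto simp: indicator_def)
  qed (use hi in simp_all)
  then have "\<forall>\<^sub>F n in sequentially. (\<integral>u. indicator {real n..} u * h u \<partial>lborel) < \<epsilon>"
    using e by (intro order_tendstoD(2)[of _ 0]) simp_all
  then obtain n where n: "(\<integral>u. indicator {real n..} u * h u \<partial>lborel) < \<epsilon>"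
    unfolding eventually_sequentially by blast
  have "(LBINT u:{max \<tau> (real n)..t}. b u) \<le> \<epsilon>" for t
  proof -
    have "(LBINT u:{max \<tau> (real n)..t}. b u) \<le> (\<integral>u. indicator {real n..} u * h u \<partial>lborel)"
      unfolding set_lebesgue_integral_def
    proof (rule integral_mono')
      show "integrable lborel (\<lambda>u. indicator {real n..} u * h u)"
        using integrable_mult_indicator[OF _ hi, of "{real n..}"] by simp
    qed (use nn in \<open>auto simp: h_def indicator_def\<close>)
    then show ?thesis using n by linarith
  qed
  then show ?thesis by (intro exI[of _ "max \<tau> (real n)"]) auto
qed

text \<open>
  The bound on compact intervals passes to the limit because \<open>b\<close> is the density of a measure, which is
  continuous from below.
\<close>

lemma nn_integral_bounded_by_intervals:
  fixes b :: "real \<Rightarrow> real"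
  assumes [measurable]: "b \<in> borel_measurable borel" and b: "\<And>u. 0 \<le> b u \<and> b u \<le> 1"
    and K: "\<And>t. t \<ge> s \<Longrightarrow> (LBINT u:{s..t}. b u) \<le> K"
  shows "(\<integral>\<^sup>+u\<in>{s..}. ennreal (b u) \<partial>lborel) \<le> ennreal K"
proof -
  let ?D = "density lborel (\<lambda>u. ennreal (b u))"
  have "emeasure ?D {s..s + real n} \<le> ennreal K" for n
  proof -
    have "set_integrable lborel {s..s + real n} b"
      by (rule set_integrable_bounded_interval[where K=1]) (simp_all add: b)
    then have "(\<integral>\<^sup>+u. ennreal (indicator {s..s + real n} u * b u) \<partial>lborel) = ennreal (LBINT u:{s..s + real n}. b u)"
      unfolding set_lebesgue_integral_def set_integrable_def
      by (subst nn_integral_eq_integral) (use b in auto)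
    moreover have "emeasure ?D {s..s + real n} = (\<integral>\<^sup>+u. ennreal (indicator {s..s + real n} u * b u) \<partial>lborel)"
      by (subst emeasure_density) (auto intro!: nn_integral_cong simp: indicator_def)
    ultimately show ?thesis using K[of "s + real n"] by (simp add: ennreal_leI)
  qed
  then have "(SUP n. emeasure ?D {s..s + real n}) \<le> ennreal K" by (intro SUP_least)
  also have "(SUP n. emeasure ?D {s..s + real n}) = emeasure ?D (\<Union>n. {s..s + real n})"
    by (rule SUP_emeasure_incseq) (auto simp: incseq_def)
  also have "(\<Union>n. {s..s + real n}) = {s..}"
  proof (intro set_eqI iffI)
    fix x assume "x \<in> {s..}"
    moreover obtain n :: nat where "x - s \<le> real n" using real_arch_simple by blast
    ultimately show "x \<in> (\<Union>n. {s..s + real n})" by (auto intro!: exI[of _ n])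
  qed auto
  finally show ?thesis by (simp add: emeasure_density)
qed

section \<open>Limits in total variation\<close>

lemma integrable_measure_pmf_le1:
  assumes "\<And>x. \<bar>f x :: real\<bar> \<le> 1"
  shows "integrable (measure_pmf \<mu>) f"
  by (rule measure_pmf.integrable_const_bound[where B=1]) (use assms in auto)

text \<open>
  Completeness of the total variation distance. The limit has as point masses the limits of the point
  masses. No mass is lost, because the expectations converge uniformly over all functions bounded by
  \<open>1\<close>: a finite set that carries almost all mass of \<open>\<mu> s\<close>, for one suitable \<open>s\<close>, carries almost all mass
  in the limit.
\<close>

lemma pmf_limit_of_total_variation_Cauchy:
  fixes \<mu> :: "real \<Rightarrow> 'b pmf"
  assumes Cauchy: "\<And>\<epsilon>. \<epsilon> > 0 \<Longrightarrow> \<exists>s. \<forall>t\<ge>s. \<forall>f. (\<forall>x. \<bar>f x\<bar> \<le> (1::real)) \<longrightarrow>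
      \<bar>measure_pmf.expectation (\<mu> t) f - measure_pmf.expectation (\<mu> s) f\<bar> \<le> \<epsilon>"
  shows "\<exists>\<pi>. \<forall>f. (\<forall>x. \<bar>f x\<bar> \<le> (1::real)) \<longrightarrow>
      ((\<lambda>t. measure_pmf.expectation (\<mu> t) f) \<longlongrightarrow> measure_pmf.expectation \<pi> f) at_top"
proof -
  let ?E = "measure_pmf.expectation"
  define adm where "adm f \<longleftrightarrow> (\<forall>x. \<bar>f x\<bar> \<le> (1::real))" for f :: "'b \<Rightarrow> real"
  have intg: "integrable (measure_pmf \<nu>) f" if "adm f" for f and \<nu> :: "'b pmf"
    using that by (intro integrable_measure_pmf_le1) (auto simp: adm_def)
  have ex: "\<exists>l. ((\<lambda>t. ?E (\<mu> t) f) \<longlongrightarrow> l) at_top" if f: "adm f" for f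
  proof -
    have "cauchy_filter (filtermap (\<lambda>t. ?E (\<mu> t) f) at_top)"
      unfolding cauchy_filter_metric_filtermap
    proof (intro allI impI)
      fix e :: real assume "e > 0"
      then obtain s where s: "\<And>t. t \<ge> s \<Longrightarrow> \<bar>?E (\<mu> t) f - ?E (\<mu> s) f\<bar> \<le> e / 3"
        using Cauchy[of "e/3"] f unfolding adm_def by (metis divide_pos_pos zero_less_numeral)
      show "\<exists>P. eventually P at_top \<and> (\<forall>x y. P x \<and> P y \<longrightarrow> dist (?E (\<mu> x) f) (?E (\<mu> y) f) < e)"
      proof (intro exI[of _ "\<lambda>t. t \<ge> s"] conjI allI impI)
        fix x y assume "s \<le> x \<and> s \<le> y"
        with s[of x] s[of y] \<open>e > 0\<close> show "dist (?E (\<mu> x) f) (?E (\<mu> y) f) < e"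
          unfolding dist_real_def by linarith
      qed (rule eventually_ge_at_top)
    qed
    then show ?thesis
      using cauchy_filter_complete_converges[of "filtermap (\<lambda>t. ?E (\<mu> t) f) at_top" UNIV] complete_UNIV
      by (simp add: filterlim_def filtermap_bot_iff)
  qed
  define L where "L f = (THE l::real. ((\<lambda>t. ?E (\<mu> t) f) \<longlongrightarrow> l) at_top)" for f
  have L: "((\<lambda>t. ?E (\<mu> t) f) \<longlongrightarrow> L f) at_top" if "adm f" for f
    using ex[OF that] unfolding L_def
    by (metis (mono_tags, lifting) tendsto_unique the_equality trivial_limit_at_top_linorder)
  have Leq: "L f = l" if "((\<lambda>t. ?E (\<mu> t) f) \<longlongrightarrow> l) at_top" for f l
    unfolding L_def using that
    by (metis (mono_tags, lifting) tendsto_unique the_equality trivial_limit_at_top_linorder)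
  have near: "\<exists>s. \<forall>f. adm f \<longrightarrow> \<bar>L f - ?E (\<mu> s) f\<bar> \<le> \<epsilon>" if e: "\<epsilon> > 0" for \<epsilon>
  proof -
    obtain s where s: "\<And>t f. t \<ge> s \<Longrightarrow> adm f \<Longrightarrow> \<bar>?E (\<mu> t) f - ?E (\<mu> s) f\<bar> \<le> \<epsilon>"
      using Cauchy[OF e] unfolding adm_def by metis
    have "\<bar>L f - ?E (\<mu> s) f\<bar> \<le> \<epsilon>" if f: "adm f" for f
      by (rule tendsto_upperbound[of "\<lambda>t. \<bar>?E (\<mu> t) f - ?E (\<mu> s) f\<bar>" _ at_top])
         (auto intro!: tendsto_intros L f eventually_mono[OF eventually_ge_at_top[of s]] s)
    then show ?thesis by blast
  qed
  have mono: "L f \<le> L g" if "adm f" "adm g" "\<And>x. f x \<le> g x" for f g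
    by (rule tendsto_le[OF _ L[OF that(2)] L[OF that(1)]])
       (use that in \<open>auto intro!: always_eventually integral_mono intg\<close>)
  define w where "w x = L (indicator {x})" for x
  have adm_ind: "adm (indicator A)" for A by (auto simp: adm_def indicator_def)
  have Lsum: "L (\<lambda>x. indicator A x * f x) = (\<Sum>x\<in>A. w x * f x)" if "finite A" "adm f" for A f
  proof (rule Leq)
    have *: "?E (\<mu> t) (\<lambda>x. indicator A x * f x) = (\<Sum>x\<in>A. ?E (\<mu> t) (indicator {x}) * f x)" for t
    proof -
      have "?E (\<mu> t) (\<lambda>x. indicator A x * f x) = (\<Sum>x\<in>A. pmf (\<mu> t) x *\<^sub>R (indicator A x * f x))"
        by (rule integral_measure_pmf[OF that(1)]) (auto simp: indicator_def split: if_splits)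
      also have "\<dots> = (\<Sum>x\<in>A. ?E (\<mu> t) (indicator {x}) * f x)"
        by (rule sum.cong) (auto simp: measure_pmf_single)
      finally show ?thesis .
    qed
    show "((\<lambda>t. ?E (\<mu> t) (\<lambda>x. indicator A x * f x)) \<longlongrightarrow> (\<Sum>x\<in>A. w x * f x)) at_top"
      unfolding * w_def by (intro tendsto_intros L adm_ind)
  qed
  have w0: "w x \<ge> 0" for x
    unfolding w_def by (rule tendsto_lowerbound[OF L[OF adm_ind]]) auto
  have Lind: "L (indicator A) = (\<Sum>x\<in>A. w x)" if "finite A" for A
    using Lsum[OF that, of "\<lambda>_. 1"] by (simp add: adm_def)
  have L1: "L (\<lambda>_. 1) = 1" by (rule Leq) simp
  have le1: "(\<Sum>x\<in>A. w x) \<le> 1" if "finite A" for A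
    using mono[OF adm_ind[of A], of "\<lambda>_. 1"] Lind[OF that] L1
    by (simp add: adm_def indicator_def)
  have tight: "\<exists>A. finite A \<and> 1 - \<epsilon> \<le> (\<Sum>x\<in>A. w x)" if e: "\<epsilon> > 0" for \<epsilon>
  proof -
    obtain s where s: "\<And>f. adm f \<Longrightarrow> \<bar>L f - ?E (\<mu> s) f\<bar> \<le> \<epsilon> / 2"
      using near[of "\<epsilon>/2"] e by auto
    have "pmf (\<mu> s) summable_on UNIV" "infsum (pmf (\<mu> s)) UNIV = 1"
      using pmf_abs_summable[of "\<mu> s" UNIV] infsetsum_pmf_eq_1[of "\<mu> s" UNIV]
      by (auto simp: infsetsum_infsum
            intro: summable_on_iff_abs_summable_on_real[THEN iffD2] abs_summable_equivalent[THEN iffD2])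
    then have "(pmf (\<mu> s) has_sum 1) UNIV"
      by (metis has_sum_infsum)
    moreover have "\<epsilon> / 2 > 0" using e by simp
    ultimately have "\<forall>\<^sub>F A in finite_subsets_at_top UNIV. dist (sum (pmf (\<mu> s)) A) 1 < \<epsilon> / 2"
      unfolding has_sum_def tendsto_iff by blast
    then obtain A where A: "finite A" "dist (sum (pmf (\<mu> s)) A) 1 < \<epsilon> / 2"
      unfolding eventually_finite_subsets_at_top by auto
    have "?E (\<mu> s) (indicator A) = sum (pmf (\<mu> s)) A"
      using A(1) by (simp add: measure_measure_pmf_finite)
    then have "1 - \<epsilon> \<le> (\<Sum>x\<in>A. w x)"
      using A(2) s[OF adm_ind[of A]] Lind[OF A(1)] unfolding dist_real_def by linarith
    then show ?thesis using A(1) by auto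
  qed
  have "(w has_sum 1) UNIV"
    unfolding has_sum_def tendsto_iff
  proof (intro allI impI)
    fix e :: real assume "e > 0"
    then obtain A where A: "finite A" "1 - e / 2 \<le> (\<Sum>x\<in>A. w x)" using tight[of "e/2"] by auto
    have "dist (sum w B) 1 < e" if "finite B" "A \<subseteq> B" for B
      using le1[OF that(1)] sum_mono2[OF that, of w] w0 A(2) \<open>e > 0\<close>
      by (auto simp: dist_real_def abs_if)
    then show "\<forall>\<^sub>F B in finite_subsets_at_top UNIV. dist (sum w B) 1 < e"
      unfolding eventually_finite_subsets_at_top using A(1) by auto
  qed
  then have sums: "w summable_on UNIV" "infsum w UNIV = 1"
    by (auto simp: infsumI has_sum_imp_summable)
  have abs: "Infinite_Set_Sum.abs_summable_on w UNIV"
    using summable_on_iff_abs_summable_on_real[THEN iffD1, OF sums(1)]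
    by (rule abs_summable_equivalent[THEN iffD1])
  have nn: "(\<integral>\<^sup>+ x. ennreal (w x) \<partial>count_space UNIV) = 1"
    using nn_integral_conv_infsetsum[OF abs] w0 sums(2) infsetsum_infsum[OF abs] by simp
  define \<pi> where "\<pi> = embed_pmf w"
  have pmf_\<pi>: "pmf \<pi> x = w x" for x
    unfolding \<pi>_def by (rule pmf_embed_pmf[OF w0 nn])
  have "L f = ?E \<pi> f" if f: "adm f" for f
  proof -
    have "\<bar>L f - ?E \<pi> f\<bar> \<le> 0 + e" if "e > 0" for e
    proof -
      obtain A where A: "finite A" "1 - e / 2 \<le> (\<Sum>x\<in>A. w x)" using tight[of "e/2"] \<open>e > 0\<close> by auto
      let ?g = "\<lambda>x. indicator A x * f x" and ?h = "\<lambda>x. 1 - indicator A x :: real"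
      have adm: "adm ?g" "adm ?h" "adm (\<lambda>x. f x - ?g x)" "adm (\<lambda>x. - ?h x)"
        using f by (auto simp: adm_def indicator_def)
      have 1: "L ?g = ?E \<pi> ?g"
        unfolding Lsum[OF A(1) f]
        by (subst integral_measure_pmf[OF A(1)])
           (auto simp: pmf_\<pi> indicator_def intro!: sum.cong split: if_splits)
      have Lh: "L ?h = 1 - (\<Sum>x\<in>A. w x)"
      proof (rule Leq)
        have "((\<lambda>t. 1 - ?E (\<mu> t) (indicator A)) \<longlongrightarrow> 1 - L (indicator A)) at_top"
          by (intro tendsto_intros L adm_ind)
        then show "((\<lambda>t. ?E (\<mu> t) ?h) \<longlongrightarrow> 1 - (\<Sum>x\<in>A. w x)) at_top"
          by (simp add: intg adm_ind Lind[OF A(1)])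
      qed
      have Eh: "?E \<pi> ?h = 1 - (\<Sum>x\<in>A. w x)"
        using A(1) by (simp add: intg adm_ind measure_measure_pmf_finite pmf_\<pi>)
      have Ld: "L (\<lambda>x. f x - ?g x) = L f - L ?g"
        by (rule Leq) (simp add: intg f adm, intro tendsto_intros L f adm)
      have Lm: "L (\<lambda>x. - ?h x) = - L ?h"
        by (rule Leq) (use tendsto_minus[OF L[OF adm(2)]] in \<open>simp del: Bochner_Integration.integral_diff minus_diff_eq\<close>)
      \<comment> \<open>off the finite set \<open>A\<close> the function \<open>f\<close> is dominated by \<open>?h\<close>, whose expectation is the mass missed by \<open>A\<close>\<close>
      have bd: "f x - ?g x \<le> ?h x" "- ?h x \<le> f x - ?g x" for x
        using f by (auto simp: adm_def indicator_def abs_le_iff minus_le_iff)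
      have "L f - L ?g \<le> L ?h" "- L ?h \<le> L f - L ?g"
        using mono[OF adm(3,2) bd(1)] mono[OF adm(4,3) bd(2)] Ld Lm by auto
      moreover have "?E \<pi> (\<lambda>x. f x - ?g x) \<le> ?E \<pi> ?h" "?E \<pi> (\<lambda>x. - ?h x) \<le> ?E \<pi> (\<lambda>x. f x - ?g x)"
        by (rule integral_mono[OF intg intg]; (rule adm bd))+
      ultimately show ?thesis
        using 1 Lh Eh A(2) intg[OF f] intg[OF adm(1)]
        by (simp add: intg adm_ind)
    qed
    then have "\<bar>L f - ?E \<pi> f\<bar> \<le> 0" by (rule field_le_epsilon)
    then show ?thesis by simp
  qed
  then show ?thesis using L unfolding adm_def by metis
qed

lemma measurable_pair_measure_pmf:
  fixes f :: "'b::countable \<Rightarrow> 'c \<Rightarrow> real"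
  assumes "\<And>s. f s \<in> borel_measurable N"
  shows "(\<lambda>(u, s). f s u) \<in> borel_measurable (N \<Otimes>\<^sub>M measure_pmf p)"
  unfolding case_prod_unfold
  by (rule measurable_compose_countable'[where I=UNIV and g=snd and f="\<lambda>s x. f s (fst x)"])
     (rule measurable_compose[OF measurable_fst assms], auto)

lemma pmf_of_countable_prob_space:
  fixes D :: "'b::countable measure"
  assumes "prob_space D" "sets D = UNIV"
  shows "\<exists>\<mu>. measure_pmf \<mu> = D"
proof -
  interpret prob_space D by fact
  have sp: "space D = UNIV" using sets_eq_imp_space_eq[of D "count_space UNIV"] assms(2) by simp
  have "(\<Union>x\<in>{x. measure D {x} = 0}. {x}) \<in> null_sets D"
    by (rule null_sets_UN') (auto simp: null_sets_def assms(2) emeasure_eq_measure)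
  then have "AE x in D. x \<notin> {x. measure D {x} = 0}"
    by (intro AE_not_in) simp
  then have "D \<in> {M. prob_space M \<and> sets M = UNIV \<and> (AE x in M. measure M {x} \<noteq> 0)}"
    using assms by simp
  then show ?thesis using Abs_pmf_inverse by blast
qed

section \<open>Exponential decay and the logarithmic moment\<close>

text \<open>
  The union bound, for independent events of which \<open>n i\<close> have probability \<open>x i\<close>.
\<close>

lemma one_minus_prod_le_sum:
  fixes x :: "'i \<Rightarrow> real"
  assumes "finite A" "\<And>i. i \<in> A \<Longrightarrow> 0 \<le> x i \<and> x i \<le> 1"
  shows "1 - (\<Prod>i\<in>A. (1 - x i) ^ n i) \<le> (\<Sum>i\<in>A. real (n i) * x i)"
  using assms
proof (induction A rule: finite_induct)
  case (insert a A)
  let ?P = "\<Prod>i\<in>A. (1 - x i) ^ n i"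
  have P: "0 \<le> ?P" "?P \<le> 1" using insert by (auto intro!: prod_nonneg prod_le_1 power_le_one)
  have a: "1 - real (n a) * x a \<le> (1 - x a) ^ n a"
    using Bernoulli_inequality[of "- x a" "n a"] insert.prems[of a] by simp
  have "1 - (1 - x a) ^ n a * ?P = (1 - (1 - x a) ^ n a) * ?P + (1 - ?P)" by (simp add: algebra_simps)
  also have "\<dots> \<le> (1 - (1 - x a) ^ n a) * 1 + (1 - ?P)"
    using P insert.prems[of a] by (intro add_mono mult_left_mono) (auto intro!: power_le_one)
  also have "\<dots> \<le> real (n a) * x a + (\<Sum>i\<in>A. real (n i) * x i)"
    using a insert by auto
  finally show ?case using insert by simp
qed simp

lemma prod_one_minus_le_exp:
  fixes x :: "'i \<Rightarrow> real"
  assumes "finite A" "\<And>i. i \<in> A \<Longrightarrow> 0 \<le> x i \<and> x i \<le> 1"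
  shows "(\<Prod>i\<in>A. (1 - x i) ^ n i) \<le> exp (- (\<Sum>i\<in>A. real (n i) * x i))"
proof -
  have "(\<Prod>i\<in>A. (1 - x i) ^ n i) \<le> (\<Prod>i\<in>A. exp (- x i) ^ n i)"
    using assms exp_ge_add_one_self[of "- x _"] by (intro prod_mono conjI power_mono zero_le_power) auto
  also have "\<dots> = exp (- (\<Sum>i\<in>A. real (n i) * x i))"
    using assms by (simp add: exp_sum sum_negf[symmetric] exp_of_nat_mult[symmetric])
  finally show ?thesis .
qed

lemma nn_integral_exp_tail:
  assumes d: "(d::real) > 0"
  shows "(\<integral>\<^sup>+u\<in>{v..}. ennreal (exp (- d * u)) \<partial>lborel) = ennreal (exp (- d * v) / d)"
proof -
  have "(\<integral>\<^sup>+u\<in>{v..}. ennreal (exp (- d * u)) \<partial>lborel) = ennreal (0 - (- exp (- d * v) / d))"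
  proof (rule nn_integral_FTC_atLeast)
    show "((\<lambda>u. - exp (- d * u) / d) \<longlongrightarrow> 0) at_top" using d by real_asymp
  qed (use d in \<open>auto intro!: derivative_eq_intros\<close>)
  then show ?thesis by simp
qed

text \<open>
  The bound \<open>K * n * exp (- d * u)\<close> falls below the constant \<open>K\<close> at about the time \<open>ln (n + 1) / d\<close>. The
  trivial bound \<open>1\<close> is used before that time and the exponential one after it.
\<close>

lemma nn_integral_exp_capped_le:
  fixes h :: "real \<Rightarrow> real"
  assumes [measurable]: "h \<in> borel_measurable borel" and d: "d > 0" and "K \<ge> 0" "n \<ge> 0" "\<tau> \<ge> 0"
    and h: "\<And>u. u \<ge> \<tau> \<Longrightarrow> h u \<le> 1" "\<And>u. u \<ge> \<tau> \<Longrightarrow> h u \<le> K * n * exp (- d * u)"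
  shows "(\<integral>\<^sup>+u\<in>{\<tau>..}. ennreal (h u) \<partial>lborel) \<le> ennreal ((ln (n + 1) + K) / d)"
proof -
  define v where "v = ln (n + 1) / d"
  have v: "v \<ge> 0" using d \<open>n \<ge> 0\<close> by (simp add: v_def)
  have "(\<integral>\<^sup>+u\<in>{\<tau>..}. ennreal (h u) \<partial>lborel)
      \<le> (\<integral>\<^sup>+u. indicator {0..v} u + ennreal (K * n) * (ennreal (exp (- d * u)) * indicator {v..} u) \<partial>lborel)"
  proof (rule nn_integral_mono)
    fix u :: real
    have "ennreal (h u) \<le> 1" "ennreal (h u) \<le> ennreal (K * n) * ennreal (exp (- d * u))" if "u \<ge> \<tau>"
      using h[OF that] assms by (auto simp flip: ennreal_mult intro!: ennreal_leI)
    then show "ennreal (h u) * indicator {\<tau>..} u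
        \<le> indicator {0..v} u + ennreal (K * n) * (ennreal (exp (- d * u)) * indicator {v..} u)"
      using \<open>\<tau> \<ge> 0\<close> v by (cases "u \<le> v") (auto simp: indicator_def intro: add_increasing2)
  qed
  also have "\<dots> = ennreal v + ennreal (K * n) * ennreal (exp (- d * v) / d)"
    using v by (simp add: nn_integral_add nn_integral_cmult nn_integral_exp_tail[OF d, simplified])
  also have "\<dots> = ennreal (v + K * (n / (n + 1)) / d)"
    using assms v by (simp add: v_def exp_minus field_simps flip: ennreal_mult ennreal_plus)
  also have "\<dots> \<le> ennreal (v + K * 1 / d)"
    using assms by (intro ennreal_leI add_left_mono divide_right_mono mult_left_mono) auto
  finally show ?thesis by (simp add: v_def add_divide_distrib)
qed

text \<open>
  Up to the time \<open>ln (n + 1) / d\<close> the quantity \<open>n * exp (- d * u)\<close> stays above \<open>n / (n + 1)\<close>, which is at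
  least \<open>1 / 2\<close> unless \<open>n = 0\<close>; so the integrand is bounded away from \<open>0\<close> on an interval of logarithmic
  length.
\<close>

lemma nn_integral_exp_capped_ge:
  fixes h :: "real \<Rightarrow> real"
  assumes [measurable]: "h \<in> borel_measurable borel" and d: "d > 0" and "c > 0" "\<tau> \<ge> 0"
    and h: "\<And>u. u \<ge> \<tau> \<Longrightarrow> h u \<ge> 1 - exp (- c * real n * exp (- d * u))"
  shows "ennreal (1 - exp (- c / 2)) * ennreal (ln (real n + 1) / d)
      \<le> ennreal (1 - exp (- c / 2)) * ennreal \<tau> + (\<integral>\<^sup>+u\<in>{\<tau>..}. ennreal (h u) \<partial>lborel)"
proof (cases "n = 0")
  case False
  define a where "a = 1 - exp (- c / 2)"
  define v where "v = ln (real n + 1) / d"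
  have a: "a > 0" using \<open>c > 0\<close> by (simp add: a_def)
  have v: "v \<ge> 0" using d by (simp add: v_def)
  have "a \<le> h u" if u: "\<tau> \<le> u" "u \<le> v" for u
  proof -
    have "d * u \<le> ln (real n + 1)" using u d by (simp add: v_def field_simps)
    then have "exp (- d * u) \<ge> exp (- ln (real n + 1))" by simp
    then have "exp (- d * u) \<ge> 1 / (real n + 1)" by (simp add: exp_minus field_simps)
    then have "real n * exp (- d * u) \<ge> real n * (1 / (real n + 1))" by (intro mult_left_mono) auto
    moreover have "real n * (1 / (real n + 1)) \<ge> 1 / 2" using False by (simp add: field_simps)
    ultimately have "real n * exp (- d * u) \<ge> 1 / 2" by linarith
    then have "c * (real n * exp (- d * u)) \<ge> c * (1 / 2)" using \<open>c > 0\<close> by (intro mult_left_mono) auto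
    then have "exp (- (c * (real n * exp (- d * u)))) \<le> exp (- (c * (1 / 2)))" by (simp only: exp_le_cancel_iff neg_le_iff_le)
    then have "exp (- c * real n * exp (- d * u)) \<le> exp (- c / 2)" by (simp only: mult.assoc mult_minus_left) simp
    then show ?thesis unfolding a_def using h[OF u(1)] by linarith
  qed
  then have "(\<integral>\<^sup>+u. ennreal a * indicator {\<tau>..v} u \<partial>lborel) \<le> (\<integral>\<^sup>+u\<in>{\<tau>..}. ennreal (h u) \<partial>lborel)"
    by (intro nn_integral_mono) (auto simp: indicator_def intro!: ennreal_leI)
  moreover have "(\<integral>\<^sup>+u. ennreal a * indicator {\<tau>..v} u \<partial>lborel) = ennreal a * ennreal (v - \<tau>)"
    by (cases "\<tau> \<le> v") (auto simp: nn_integral_cmult_indicator ennreal_neg)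
  moreover have "ennreal a * ennreal v \<le> ennreal a * ennreal \<tau> + ennreal a * ennreal (v - \<tau>)"
    using \<open>\<tau> \<ge> 0\<close> v a by (cases "\<tau> \<le> v")
      (auto simp flip: ennreal_mult distrib_left ennreal_plus simp: ennreal_neg intro!: ennreal_leI mult_left_mono)
  ultimately have "ennreal a * ennreal v \<le> ennreal a * ennreal \<tau> + (\<integral>\<^sup>+u\<in>{\<tau>..}. ennreal (h u) \<partial>lborel)"
    by (metis (no_types, lifting) add_left_mono order_trans)
  then show ?thesis unfolding a_def v_def .
qed simp

text \<open>
  The decay rates may differ between the queues. The smallest one gives a common upper bound; their
  sum, which is at least as large as each of them, gives a common lower bound.
\<close>

lemma exp_Theta_uniform:
  fixes Q :: "'j::finite \<Rightarrow> real \<Rightarrow> real"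
  assumes Q: "\<And>j u. u \<ge> 0 \<Longrightarrow> 0 \<le> Q j u"
    and Theta: "\<And>j. \<exists>\<delta>>0. Q j \<in> \<Theta>(\<lambda>\<tau>. exp (- \<delta> * \<tau>))"
  shows "\<exists>d>0. \<exists>K\<ge>0. \<forall>\<^sub>F u in at_top. \<forall>j. Q j u \<le> K * exp (- d * u)"
    and "\<exists>d>0. \<exists>c>0. \<forall>\<^sub>F u in at_top. \<forall>j. c * exp (- d * u) \<le> Q j u"
proof -
  obtain \<delta> where \<delta>: "\<And>j. \<delta> j > 0" "\<And>j. Q j \<in> \<Theta>(\<lambda>\<tau>. exp (- \<delta> j * \<tau>))"
    using Theta by metis
  have "\<exists>K>0. \<forall>\<^sub>F u in at_top. norm (Q j u) \<le> K * norm (exp (- \<delta> j * u))" for j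
    using bigthetaD1[OF \<delta>(2)[of j]] by (elim landau_o.bigE) auto
  then obtain K where K: "\<And>j. K j > 0" "\<And>j. \<forall>\<^sub>F u in at_top. norm (Q j u) \<le> K j * norm (exp (- \<delta> j * u))"
    by metis
  have "\<exists>c>0. \<forall>\<^sub>F u in at_top. norm (Q j u) \<ge> c * norm (exp (- \<delta> j * u))" for j
    using bigthetaD2[OF \<delta>(2)[of j]] by (elim landau_omega.bigE) auto
  then obtain c where c: "\<And>j. c j > 0" "\<And>j. \<forall>\<^sub>F u in at_top. norm (Q j u) \<ge> c j * norm (exp (- \<delta> j * u))"
    by metis
  have ev: "\<forall>\<^sub>F u in at_top. \<forall>j. Q j u \<le> K j * exp (- \<delta> j * u) \<and> c j * exp (- \<delta> j * u) \<le> Q j u \<and> u \<ge> 0"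
  proof (rule eventually_all_finite)
    fix j
    show "\<forall>\<^sub>F u in at_top. Q j u \<le> K j * exp (- \<delta> j * u) \<and> c j * exp (- \<delta> j * u) \<le> Q j u \<and> u \<ge> 0"
      using K(2)[of j] c(2)[of j] eventually_ge_at_top[of "0::real"]
    proof eventually_elim
      case (elim u)
      then show ?case using Q[of u j] by auto
    qed
  qed
  define dm where "dm = Min (range \<delta>)"
  define cm where "cm = Min (range c)"
  have dm: "dm > 0" "dm \<le> \<delta> j" for j using \<delta>(1) by (auto simp: dm_def)
  have cm: "cm > 0" "cm \<le> c j" for j using c(1) by (auto simp: cm_def)
  have Ks: "K j \<le> sum K UNIV" for j using K(1) by (intro member_le_sum) (auto intro: less_imp_le)
  have ds: "\<delta> j \<le> sum \<delta> UNIV" for j using \<delta>(1) by (intro member_le_sum) (auto intro: less_imp_le)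
  have "\<forall>\<^sub>F u in at_top. \<forall>j. Q j u \<le> sum K UNIV * exp (- dm * u)"
    using ev
  proof (eventually_elim, intro allI)
    fix u j assume *: "\<forall>j. Q j u \<le> K j * exp (- \<delta> j * u) \<and> c j * exp (- \<delta> j * u) \<le> Q j u \<and> u \<ge> 0"
    have "K j * exp (- \<delta> j * u) \<le> sum K UNIV * exp (- dm * u)"
      using * dm(2)[of j] Ks[of j] K(1) less_imp_le[OF K(1)] by (intro mult_mono sum_nonneg) (auto intro: mult_right_mono)
    then show "Q j u \<le> sum K UNIV * exp (- dm * u)" using * by (meson order_trans)
  qed
  then show "\<exists>d>0. \<exists>K\<ge>0. \<forall>\<^sub>F u in at_top. \<forall>j. Q j u \<le> K * exp (- d * u)"
    using dm(1) sum_nonneg[of UNIV K] less_imp_le[OF K(1)] by blast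
  have "\<forall>\<^sub>F u in at_top. \<forall>j. cm * exp (- sum \<delta> UNIV * u) \<le> Q j u"
    using ev
  proof (eventually_elim, intro allI)
    fix u j assume *: "\<forall>j. Q j u \<le> K j * exp (- \<delta> j * u) \<and> c j * exp (- \<delta> j * u) \<le> Q j u \<and> u \<ge> 0"
    have "cm * exp (- sum \<delta> UNIV * u) \<le> c j * exp (- \<delta> j * u)"
      using * cm ds[of j] less_imp_le[OF c(1)[of j]] by (intro mult_mono) (auto intro: mult_right_mono)
    then show "cm * exp (- sum \<delta> UNIV * u) \<le> Q j u" using * by (meson order_trans)
  qed
  moreover have "sum \<delta> UNIV > 0" using \<delta>(1) by (intro sum_pos) auto
  ultimately show "\<exists>d>0. \<exists>c>0. \<forall>\<^sub>F u in at_top. \<forall>j. c * exp (- d * u) \<le> Q j u"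
    using cm(1) by blast
qed

text \<open>
  Here \<open>b u\<close> is the probability that a batch still has a customer in the network at age \<open>u\<close>. By Tonelli
  the integral of \<open>b\<close> is an expectation over the batch \<open>s\<close> of an integral over \<open>u\<close>, and by the two
  previous estimates the inner integral of a batch with \<open>n\<close> customers is of the order of \<open>ln (n + 1)\<close>,
  up to additive and multiplicative constants.
\<close>

lemma occupation_integral_finite_iff_log_moment:
  fixes Q :: "'j::finite \<Rightarrow> real \<Rightarrow> real" and p :: "(nat ^ 'j) pmf"
  defines "b \<equiv> \<lambda>u. measure_pmf.expectation p (\<lambda>s. 1 - (\<Prod>j\<in>UNIV. (1 - Q j u) ^ (s $ j)))"
  assumes [measurable]: "\<And>j. Q j \<in> borel_measurable borel"
    and Q: "\<And>j u. 0 \<le> Q j u \<and> Q j u \<le> 1"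
    and Theta: "\<And>j. \<exists>\<delta>>0. Q j \<in> \<Theta>(\<lambda>\<tau>. exp (- \<delta> * \<tau>))"
  shows "(\<exists>\<tau>\<ge>0. (\<integral>\<^sup>+u\<in>{\<tau>..}. ennreal (b u) \<partial>lborel) < \<infinity>) \<longleftrightarrow>
    (\<integral>\<^sup>+ s. ennreal (ln (real (\<Sum>j\<in>UNIV. s $ j) + 1)) \<partial>measure_pmf p) < \<infinity>"
proof -
  define g where "g s u = 1 - (\<Prod>j\<in>UNIV. (1 - Q j u) ^ (s $ j))" for s :: "nat ^ 'j" and u
  have [measurable]: "g s \<in> borel_measurable borel" for s unfolding g_def by measurable
  have g: "0 \<le> g s u" "g s u \<le> 1" for s u
    unfolding g_def using Q by (auto intro!: prod_le_1 prod_nonneg power_le_one simp: )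
  have ub: "g s u \<le> (\<Sum>j\<in>UNIV. real (s $ j) * Q j u)" for s u
    unfolding g_def using Q by (intro one_minus_prod_le_sum) auto
  have lb: "g s u \<ge> 1 - exp (- (\<Sum>j\<in>UNIV. real (s $ j) * Q j u))" for s u
    unfolding g_def using prod_one_minus_le_exp[of UNIV "\<lambda>j. Q j u"] Q by auto
  have tonelli: "(\<integral>\<^sup>+u\<in>{\<tau>..}. ennreal (b u) \<partial>lborel) =
      (\<integral>\<^sup>+s. (\<integral>\<^sup>+u\<in>{\<tau>..}. ennreal (g s u) \<partial>lborel) \<partial>measure_pmf p)" for \<tau>
  proof -
    have "(\<integral>\<^sup>+u\<in>{\<tau>..}. ennreal (b u) \<partial>lborel) = (\<integral>\<^sup>+u. \<integral>\<^sup>+s. ennreal (g s u) * indicator {\<tau>..} u \<partial>measure_pmf p \<partial>lborel)"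
    proof (rule nn_integral_cong)
      fix u
      have "ennreal (b u) = (\<integral>\<^sup>+s. ennreal (g s u) \<partial>measure_pmf p)"
        unfolding b_def g_def[symmetric]
        by (rule nn_integral_eq_integral[symmetric])
           (use g in \<open>auto intro!: measure_pmf.integrable_const_bound[where B=1]\<close>)
      then show "ennreal (b u) * indicator {\<tau>..} u = (\<integral>\<^sup>+s. ennreal (g s u) * indicator {\<tau>..} u \<partial>measure_pmf p)"
        by (simp add: nn_integral_multc)
    qed
    also have "\<dots> = (\<integral>\<^sup>+s. \<integral>\<^sup>+u. ennreal (g s u) * indicator {\<tau>..} u \<partial>lborel \<partial>measure_pmf p)"
    proof -
      interpret pair_sigma_finite "measure_pmf p" lborel
        by unfold_locales
      have "(\<lambda>(s, u). ennreal (g s u) * indicator {\<tau>..} u) \<in> borel_measurable (measure_pmf p \<Otimes>\<^sub>M lborel)"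
        unfolding case_prod_unfold
        by (rule measurable_compose_countable'[where I=UNIV and g=fst and f="\<lambda>s x. ennreal (g s (snd x)) * indicator {\<tau>..} (snd x)"]) auto
      then show ?thesis by (rule Fubini')
    qed
    finally show ?thesis .
  qed
  define N where "N s = (\<Sum>j\<in>UNIV. s $ j)" for s :: "nat ^ 'j"
  have N: "(\<Sum>j\<in>UNIV. real (s $ j) * x) = real (N s) * x" for s x
    by (simp add: N_def sum_distrib_right)
  have "(\<exists>\<tau>\<ge>0. (\<integral>\<^sup>+u\<in>{\<tau>..}. ennreal (b u) \<partial>lborel) < \<infinity>) \<longleftrightarrow>
    (\<integral>\<^sup>+ s. ennreal (ln (real (N s) + 1)) \<partial>measure_pmf p) < \<infinity>" (is "?L \<longleftrightarrow> ?R")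
  proof
    assume ?L
    then obtain \<tau>0 where t0: "\<tau>0 \<ge> 0" "(\<integral>\<^sup>+u\<in>{\<tau>0..}. ennreal (b u) \<partial>lborel) < \<infinity>" by auto
    obtain d c \<tau>1 where dc: "d > 0" "c > 0" "\<And>u j. u \<ge> \<tau>1 \<Longrightarrow> c * exp (- d * u) \<le> Q j u"
      using exp_Theta_uniform(2)[of Q] Q Theta unfolding eventually_at_top_linorder by metis
    define \<tau> where "\<tau> = max \<tau>0 \<tau>1"
    have t: "\<tau> \<ge> 0" using t0 by (simp add: \<tau>_def)
    have "(\<integral>\<^sup>+u\<in>{\<tau>..}. ennreal (b u) \<partial>lborel) \<le> (\<integral>\<^sup>+u\<in>{\<tau>0..}. ennreal (b u) \<partial>lborel)"
      by (intro nn_integral_mono) (auto simp: \<tau>_def indicator_def)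
    then have fin: "(\<integral>\<^sup>+u\<in>{\<tau>..}. ennreal (b u) \<partial>lborel) < \<infinity>" using t0 by (meson order_le_less_trans)
    define a where "a = 1 - exp (- c / 2)"
    have a: "a > 0" using dc by (simp add: a_def)
    have "ennreal a * ennreal (ln (real (N s) + 1) / d) \<le> ennreal a * ennreal \<tau> + (\<integral>\<^sup>+u\<in>{\<tau>..}. ennreal (g s u) \<partial>lborel)" for s
      unfolding a_def
    proof (rule nn_integral_exp_capped_ge[OF _ dc(1,2) t])
      fix u assume "\<tau> \<le> u"
      have N_eq: "c * real (N s) * exp (- d * u) = (\<Sum>j\<in>UNIV. real (s $ j) * (c * exp (- d * u)))"
        by (simp add: N)
      from \<open>\<tau> \<le> u\<close> have "c * real (N s) * exp (- d * u) \<le> (\<Sum>j\<in>UNIV. real (s $ j) * Q j u)"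
        unfolding N_eq using dc(3)[of u] by (intro sum_mono mult_left_mono) (auto simp: \<tau>_def)
      then show "1 - exp (- c * real (N s) * exp (- d * u)) \<le> g s u" using lb[of s u] by (smt (verit) exp_le_cancel_iff mult_minus_left)
    qed simp
    then have "(\<integral>\<^sup>+s. ennreal a * ennreal (ln (real (N s) + 1) / d) \<partial>measure_pmf p) \<le>
       (\<integral>\<^sup>+s. ennreal a * ennreal \<tau> + (\<integral>\<^sup>+u\<in>{\<tau>..}. ennreal (g s u) \<partial>lborel) \<partial>measure_pmf p)"
      by (intro nn_integral_mono) auto
    also have "\<dots> = ennreal a * ennreal \<tau> + (\<integral>\<^sup>+u\<in>{\<tau>..}. ennreal (b u) \<partial>lborel)"
      by (simp add: nn_integral_add tonelli)
    also have "\<dots> < \<infinity>" using fin by (simp add: ennreal_mult_less_top)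
    also have "(\<integral>\<^sup>+s. ennreal a * ennreal (ln (real (N s) + 1) / d) \<partial>measure_pmf p) =
        ennreal (a / d) * (\<integral>\<^sup>+ s. ennreal (ln (real (N s) + 1)) \<partial>measure_pmf p)"
      using a dc by (subst nn_integral_cmult[symmetric])
        (auto simp: ennreal_mult'[symmetric] intro!: nn_integral_cong)
    finally show ?R
      using a dc by (auto simp: ennreal_mult_less_top)
  next
    assume R: ?R
    obtain d K \<tau>1 where dc: "d > 0" "K \<ge> 0" "\<And>u j. u \<ge> \<tau>1 \<Longrightarrow> Q j u \<le> K * exp (- d * u)"
      using exp_Theta_uniform(1)[of Q] Q Theta unfolding eventually_at_top_linorder by metis
    define \<tau> where "\<tau> = max 0 \<tau>1"
    have t: "\<tau> \<ge> 0" by (simp add: \<tau>_def)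
    have "(\<integral>\<^sup>+u\<in>{\<tau>..}. ennreal (g s u) \<partial>lborel) \<le> ennreal ((ln (real (N s) + 1) + K) / d)" for s
    proof (rule nn_integral_exp_capped_le[OF _ dc(1,2) _ t])
      fix u assume "\<tau> \<le> u"
      have N_eq: "K * real (N s) * exp (- d * u) = (\<Sum>j\<in>UNIV. real (s $ j) * (K * exp (- d * u)))"
        by (simp add: N)
      from \<open>\<tau> \<le> u\<close> have "(\<Sum>j\<in>UNIV. real (s $ j) * Q j u) \<le> K * real (N s) * exp (- d * u)"
        unfolding N_eq using dc(3)[of u] by (intro sum_mono mult_left_mono) (auto simp: \<tau>_def)
      then show "g s u \<le> K * real (N s) * exp (- d * u)" using ub[of s u] by linarith
    qed (use g in auto)
    then have "(\<integral>\<^sup>+u\<in>{\<tau>..}. ennreal (b u) \<partial>lborel) \<le> (\<integral>\<^sup>+ s. ennreal ((ln (real (N s) + 1) + K) / d) \<partial>measure_pmf p)"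
      unfolding tonelli by (intro nn_integral_mono) auto
    also have "\<dots> = (\<integral>\<^sup>+ s. ennreal (1 / d) * (ennreal (ln (real (N s) + 1)) + ennreal K) \<partial>measure_pmf p)"
      using dc by (intro nn_integral_cong) (simp add: ennreal_mult'[symmetric] flip: ennreal_plus)
    also have "\<dots> = ennreal (1 / d) * ((\<integral>\<^sup>+ s. ennreal (ln (real (N s) + 1)) \<partial>measure_pmf p) + ennreal K)"
      by (simp add: nn_integral_cmult nn_integral_add)
    also have "\<dots> < \<infinity>" using R by (simp add: ennreal_mult_less_top)
    finally show ?L using t by blast
  qed
  then show ?thesis by (simp only: N_def)
qed

section \<open>Batches with prescribed ages\<close>

text \<open>
  Makes vectors of customer counts random variables. The set \<open>A k x\<close> may be infinite, in which case
  \<open>card\<close> returns \<open>0\<close>, so such a count is not just a countable sum of indicators.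
\<close>

lemma measurable_vec_card:
  fixes A :: "'j::finite \<Rightarrow> 'a \<Rightarrow> 'c::countable set"
  assumes "\<And>k z. {x \<in> space M. z \<in> A k x} \<in> sets M"
  shows "(\<lambda>x. \<chi> k. card (A k x)) \<in> measurable M (count_space (UNIV :: (nat ^ 'j) set))"
proof (subst measurable_count_space_eq2_countable, intro conjI ballI)
  fix v :: "nat ^ 'j"
  have card: "(\<lambda>x. card (A k x)) \<in> measurable M (count_space UNIV)" for k
  proof -
    have "{x \<in> space M. i \<in> to_nat ` A k x} \<in> sets M" for i
    proof (cases "i \<in> range (to_nat :: 'c \<Rightarrow> nat)")
      case True
      then obtain z :: 'c where "i = to_nat z" by auto
      then have "{x \<in> space M. i \<in> to_nat ` A k x} = {x \<in> space M. z \<in> A k x}" by auto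
      then show ?thesis using assms by simp
    next
      case False
      then have "{x \<in> space M. i \<in> to_nat ` A k x} = {}" by blast
      then show ?thesis by (simp only: sets.empty_sets)
    qed
    then have "(\<lambda>x. card (to_nat ` A k x)) \<in> measurable M (count_space UNIV)"
      by (rule measurable_card)
    then show ?thesis by (simp add: card_image)
  qed
  have "(\<lambda>x. \<chi> k. card (A k x)) -` {v} \<inter> space M = {x \<in> space M. \<forall>k. card (A k x) = v $ k}"
    by (auto simp: vec_eq_iff)
  also have "\<dots> \<in> sets M" using card by measurable
  finally show "(\<lambda>x. \<chi> k. card (A k x)) -` {v} \<inter> space M \<in> sets M" .
qed auto

lemma (in prob_space) indep_sets_reindex:
  assumes "indep_sets E (h ` I)" "inj_on h I"
  shows "indep_sets (\<lambda>i. E (h i)) I"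
proof (rule indep_setsI)
  fix A J assume J: "J \<noteq> {}" "J \<subseteq> I" "finite J" and A: "\<forall>j\<in>J. A j \<in> E (h j)"
  have inj: "inj_on h J" using assms(2) J(2) by (rule inj_on_subset)
  have "prob (\<Inter>k\<in>h ` J. A (the_inv_into J h k)) = (\<Prod>k\<in>h ` J. prob (A (the_inv_into J h k)))"
    using assms(1) J A inj by (intro indep_setsD) (auto simp: the_inv_into_f_f)
  then show "prob (\<Inter>j\<in>J. A j) = (\<Prod>j\<in>J. prob (A j))"
    using inj by (simp add: the_inv_into_f_f prod.reindex cong: INF_cong_simp)
qed (use assms(1) in \<open>auto simp: indep_sets_def\<close>)

context infinite_server_network
begin

text \<open>
  All randomness other than the arrival times, collected in one \<open>\<sigma>\<close>-algebra that is independent of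
  them and for which the movements are still jointly measurable in time and outcome. This makes
  it possible to condition on the arrival times although the processes are evaluated at random ages.
\<close>

lemma sigma_algebra_without_arrivals:
  "\<exists>G. subalgebra M G \<and> (\<forall>i. S i \<in> measurable G (count_space UNIV)) \<and>
     (\<forall>i j l. (\<lambda>(t, \<omega>). X i j l t \<omega>) \<in> measurable (restrict_space borel {0..} \<Otimes>\<^sub>M G) (count_space UNIV)) \<and>
     indep_set (sets (vimage_algebra (space M) (\<lambda>\<omega> i. T i \<omega>) (Pi\<^sub>M UNIV (\<lambda>_. borel)))) (sets G)"
proof -
  obtain F where sub: "\<And>i j l. subalgebra M (F i j l)"
    and XF: "\<And>i j l. (\<lambda>(t, \<omega>). X i j l t \<omega>) \<in> measurable (restrict_space borel {0..} \<Otimes>\<^sub>M F i j l) (count_space UNIV)"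
    and ind: "indep_sets (source_events M T S F) UNIV"
    using independent_sources by auto
  let ?E = "source_events M T S F"
  define G where "G = sigma (space M) (\<Union>s\<in>-{Arrivals}. ?E s)"
  have ev: "?E s \<subseteq> events" for s using ind by (auto simp: indep_sets_def)
  then have "(\<Union>s\<in>-{Arrivals}. ?E s) \<subseteq> Pow (space M)" using sets.space_closed by blast
  then have sG: "sets G = sigma_sets (space M) (\<Union>s\<in>-{Arrivals}. ?E s)" and spG: "space G = space M"
    by (auto simp: G_def)
  have EG: "?E s \<subseteq> sets G" if "s \<noteq> Arrivals" for s using that by (auto simp: sG)
  have 1: "subalgebra M G"
    unfolding subalgebra_def spG sG using ev by (auto intro!: sets.sigma_sets_subset)
  have 2: "S i \<in> measurable G (count_space UNIV)" for i
  proof (rule measurableI)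
    fix A
    have "S i -` A \<inter> space M \<in> ?E (Batch i)"
      by (auto simp: source_events_def intro: in_vimage_algebra)
    then show "S i -` A \<inter> space G \<in> sets G" using EG[of "Batch i"] by (auto simp: spG)
  qed auto
  have 3: "(\<lambda>(t, \<omega>). X i j l t \<omega>) \<in> measurable (restrict_space borel {0..} \<Otimes>\<^sub>M G) (count_space UNIV)" for i j l
  proof -
    have "(\<lambda>\<omega>. \<omega>) \<in> measurable G (F i j l)"
    proof (rule measurableI)
      show "x \<in> space (F i j l)" if "x \<in> space G" for x
        using that sub[of i j l] by (simp add: spG subalgebra_def)
      fix A assume A: "A \<in> sets (F i j l)"
      then have "A \<subseteq> space M" using sub[of i j l] sets.sets_into_space by (fastforce simp: subalgebra_def)
      then have "(\<lambda>\<omega>. \<omega>) -` A \<inter> space G = A" by (auto simp: spG)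
      then show "(\<lambda>\<omega>. \<omega>) -` A \<inter> space G \<in> sets G"
        using A EG[of "Customer i j l"] by (auto simp: source_events_def)
    qed
    then have "(\<lambda>(t, \<omega>). (t, \<omega>)) \<in> measurable (restrict_space borel {0..} \<Otimes>\<^sub>M G) (restrict_space borel {0..} \<Otimes>\<^sub>M F i j l)"
      by measurable
    from measurable_compose[OF this XF[of i j l]] show ?thesis by (simp add: case_prod_beta')
  qed
  have "indep_sets (\<lambda>b. sigma_sets (space M) (\<Union>s\<in>(if b then {Arrivals} else -{Arrivals}). ?E s)) (UNIV :: bool set)"
  proof (rule indep_sets_collect_sigma)
    show "indep_sets ?E (\<Union>j. if j then {Arrivals} else - {Arrivals})"
      by (rule indep_sets_mono_index[OF _ ind]) simp
    show "Int_stable (?E i)" for i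
      by (cases i) (auto simp: source_events_def Int_stable_def)
  qed (auto simp: disjoint_family_on_def)
  then have 4: "indep_set (sets (vimage_algebra (space M) (\<lambda>\<omega> i. T i \<omega>) (Pi\<^sub>M UNIV (\<lambda>_. borel)))) (sets G)"
    unfolding indep_set_def
  proof (rule indep_sets_mono_sets)
    fix b :: bool
    show "case_bool (sets (vimage_algebra (space M) (\<lambda>\<omega> i. T i \<omega>) (Pi\<^sub>M UNIV (\<lambda>_. borel)))) (sets G) b
      \<subseteq> sigma_sets (space M) (\<Union>s\<in>(if b then {Arrivals} else -{Arrivals}). ?E s)"
      by (cases b) (auto simp: sG source_events_def)
  qed
  show ?thesis using 1 2 3 4 by blast
qed

text \<open>
  The information about the batches \<open>m, m + 1, \<dots>\<close> when they have the prescribed ages \<open>a 0, a 1, \<dots>\<close>: for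
  the \<open>i\<close>-th of them its sizes, at index \<open>(i, None)\<close>, and the location of each of its customers. The sum
  type gives all these random variables the same type of values, as independence of a family requires.
  The offset \<open>m\<close> serves to express that batches are interchangeable.
\<close>

fun mark :: "nat \<Rightarrow> (nat \<Rightarrow> real) \<Rightarrow> nat \<times> ('j \<times> nat) option \<Rightarrow> 'a \<Rightarrow> (nat ^ 'j) + 'j option" where
  "mark m a (i, None) \<omega> = Inl (S (m + i) \<omega>)"
| "mark m a (i, Some (j, l)) \<omega> = Inr (X (m + i) j l (a i) \<omega>)"

lemma location_measurable:
  assumes "t \<ge> 0" shows "X i j l t \<in> measurable M (count_space UNIV)"
proof -
  obtain G where G: "subalgebra M G"
    "(\<lambda>(t, \<omega>). X i j l t \<omega>) \<in> measurable (restrict_space borel {0..} \<Otimes>\<^sub>M G) (count_space UNIV)"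
    using sigma_algebra_without_arrivals by blast
  have "(\<lambda>\<omega>. (t, \<omega>)) \<in> measurable G (restrict_space borel {0..} \<Otimes>\<^sub>M G)"
    using assms by (intro measurable_Pair1') (simp add: space_restrict_space)
  from measurable_compose[OF this G(2)] have "X i j l t \<in> measurable G (count_space UNIV)" by simp
  then show ?thesis using measurable_from_subalg[OF G(1)] by blast
qed

lemma indep_marks:
  assumes a: "\<And>i. a i \<ge> 0"
  shows "indep_vars (\<lambda>_. count_space UNIV) (mark m a) UNIV"
proof -
  obtain F where sub: "\<And>i j l. subalgebra M (F i j l)"
    and XF: "\<And>i j l. (\<lambda>(t, \<omega>). X i j l t \<omega>) \<in> measurable (restrict_space borel {0..} \<Otimes>\<^sub>M F i j l) (count_space UNIV)"
    and ind: "indep_sets (source_events M T S F) UNIV"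
    using independent_sources by auto
  define h :: "nat \<times> ('j \<times> nat) option \<Rightarrow> 'j source"
    where "h = (\<lambda>(i, c). case c of None \<Rightarrow> Batch (m + i) | Some (j, l) \<Rightarrow> Customer (m + i) j l)"
  have inj: "inj h" by (auto simp: h_def inj_def split: option.splits)
  have gen: "mark m a x -` A \<inter> space M \<in> source_events M T S F (h x)" for x A
  proof -
    obtain i c where x: "x = (i, c)" by (cases x)
    show ?thesis
    proof (cases c)
      case None
      have "mark m a x -` A \<inter> space M = S (m + i) -` (Inl -` A) \<inter> space M" by (auto simp: x None)
      also have "\<dots> \<in> source_events M T S F (h x)"
        by (auto simp: x None h_def source_events_def intro: in_vimage_algebra)
      finally show ?thesis .
    next
      case (Some jl)
      obtain j l where jl: "jl = (j, l)" by (cases jl)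
      have "(\<lambda>\<omega>. (a i, \<omega>)) \<in> measurable (F (m+i) j l) (restrict_space borel {0..} \<Otimes>\<^sub>M F (m+i) j l)"
        using a by (intro measurable_Pair1') (simp add: space_restrict_space)
      from measurable_compose[OF this XF[of "m+i" j l]]
      have meas: "X (m+i) j l (a i) \<in> measurable (F (m+i) j l) (count_space UNIV)" by simp
      have "mark m a x -` A \<inter> space M = X (m+i) j l (a i) -` (Inr -` A) \<inter> space (F (m+i) j l)"
        using sub[of "m+i" j l] by (auto simp: x Some jl subalgebra_def)
      also have "\<dots> \<in> sets (F (m+i) j l)" using meas by (rule measurable_sets) auto
      finally show ?thesis by (simp add: x Some jl h_def source_events_def)
    qed
  qed
  have ind': "indep_sets (\<lambda>x. source_events M T S F (h x)) UNIV"
    by (rule indep_sets_reindex[OF indep_sets_mono_index[OF _ ind] inj]) simp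
  then have "\<forall>x\<in>UNIV. source_events M T S F (h x) \<subseteq> events"
    unfolding indep_sets_def by (rule conjunct1)
  then have ev: "source_events M T S F (h x) \<subseteq> events" for x by (rule bspec) (rule UNIV_I)
  show ?thesis
    unfolding indep_vars_def2
  proof (intro conjI ballI)
    show "mark m a x \<in> measurable M (count_space UNIV)" for x
      by (rule measurableI) (simp, rule subsetD[OF ev gen])
    show "indep_sets (\<lambda>x. {mark m a x -` A \<inter> space M |A. A \<in> sets (count_space UNIV)}) UNIV"
      by (rule indep_sets_mono_sets[OF ind']) (use gen in auto)
  qed
qed

lemma location_distr:
  assumes "t \<ge> 0"
  shows "distr M (count_space UNIV) (X i j l t) = distr M (count_space UNIV) (X i' j l t)"
proof (rule measure_eqI_countable[of _ UNIV])
  have meas: "X i j l t \<in> measurable M (count_space UNIV)" for i using assms by (rule location_measurable)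
  have some: "prob (X i j l t -` {Some k} \<inter> space M) = q j k t" for i k
    using location_prob[OF assms, of i j l k] by (simp add: vimage_def Int_def conj_commute)
  have none: "prob (X i j l t -` {None} \<inter> space M) = 1 - (\<Sum>k\<in>UNIV. q j k t)" for i
  proof -
    interpret D: prob_space "distr M (count_space UNIV) (X i j l t)" by (rule prob_space_distr[OF meas])
    have "1 = measure (distr M (count_space UNIV) (X i j l t)) (UNIV :: 'j option set)"
      using D.prob_space by simp
    also have "\<dots> = (\<Sum>x\<in>UNIV. measure (distr M (count_space UNIV) (X i j l t)) {x})"
      by (rule D.finite_measure_eq_sum_singleton) auto
    also have "\<dots> = (\<Sum>x\<in>insert None (range Some). prob (X i j l t -` {x} \<inter> space M))"
      by (intro sum.cong) (simp_all only: UNIV_option_conv[symmetric], simp add: measure_distr meas)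
    also have "\<dots> = prob (X i j l t -` {None} \<inter> space M) + (\<Sum>k\<in>UNIV. q j k t)"
      by (simp add: sum.reindex some)
    finally show ?thesis by simp
  qed
  fix x :: "'j option"
  have "prob (X i j l t -` {x} \<inter> space M) = prob (X i' j l t -` {x} \<inter> space M)"
    by (cases x) (simp_all add: some none)
  then show "emeasure (distr M (count_space UNIV) (X i j l t)) {x} = emeasure (distr M (count_space UNIV) (X i' j l t)) {x}"
    by (simp add: emeasure_distr meas emeasure_eq_measure)
qed auto

text \<open>
  For prescribed ages it does not matter which batches are looked at: by independence the joint law is
  the product of the marginal laws, and these are the same for all batches.
\<close>

lemma marks_shift_invariant:
  assumes a: "\<And>i. a i \<ge> 0"
  shows "distr M (\<Pi>\<^sub>M x\<in>UNIV. count_space UNIV) (\<lambda>\<omega> x. mark m a x \<omega>) =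
         distr M (\<Pi>\<^sub>M x\<in>UNIV. count_space UNIV) (\<lambda>\<omega> x. mark 0 a x \<omega>)"
proof -
  have rv: "mark m a x \<in> measurable M (count_space UNIV)" for m x
    using conjunct1[OF iffD1[OF indep_vars_def2 indep_marks[of a m, OF a]]] by (rule bspec) (rule UNIV_I)
  have eq: "distr M (\<Pi>\<^sub>M x\<in>UNIV. count_space UNIV) (\<lambda>\<omega> x. mark m a x \<omega>) =
      (\<Pi>\<^sub>M x\<in>UNIV. distr M (count_space UNIV) (mark m a x))" for m

  proof -
    have "UNIV \<noteq> ({} :: (nat \<times> ('j \<times> nat) option) set)" by (rule UNIV_not_empty)
    from iffD1[OF indep_vars_iff_distr_eq_PiM[where M'="\<lambda>_. count_space UNIV", OF this rv] indep_marks[of a m, OF a]]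
    show ?thesis unfolding restrict_UNIV .
  qed
  have marginal: "distr M (count_space UNIV) (mark m a x) = distr M (count_space UNIV) (mark 0 a x)" for x
  proof -
    obtain i c where x: "x = (i, c)" by (cases x)
    show ?thesis
    proof (cases c)
      case None
      have "distr M (count_space UNIV) (mark m a x) = distr (distr M (count_space UNIV) (S (m + i))) (count_space UNIV) Inl" for m
      proof -
        have "mark m a x = Inl \<circ> S (m + i)" by (auto simp: x None)
        then show ?thesis using batch_measurable by (simp add: distr_distr)
      qed
      then show ?thesis by (simp only: batch_distr)
    next
      case (Some jl)
      obtain j l where jl: "jl = (j, l)" by (cases jl)
      have "distr M (count_space UNIV) (mark m a x) = distr (distr M (count_space UNIV) (X (m + i) j l (a i))) (count_space UNIV) Inr" for m
      proof -
        have "mark m a x = Inr \<circ> X (m + i) j l (a i)" by (auto simp: x Some jl)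
        then show ?thesis using location_measurable[OF a] by (simp add: distr_distr)
      qed
      then show ?thesis using location_distr[of "a i" "m + i" j l "0 + i", OF a] by (simp only:)
    qed
  qed
  have "(\<Pi>\<^sub>M x\<in>UNIV. distr M (count_space UNIV) (mark m a x)) = (\<Pi>\<^sub>M x\<in>UNIV. distr M (count_space UNIV) (mark 0 a x))"
    by (rule PiM_cong[OF refl marginal])
  then show ?thesis
    by (rule trans[OF eq[of m] trans[OF _ eq[of 0, symmetric]]])
qed

end

section \<open>The effect of an additional batch\<close>

definition arrival_times :: "(nat \<Rightarrow> real) \<Rightarrow> nat \<Rightarrow> real" where
  "arrival_times g i = (\<Sum>m\<le>i. g m)"

text \<open>
  The queue lengths due to the batches with index in \<open>D\<close>, as a function of the marks \<open>y\<close>.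
\<close>

definition population :: "nat set \<Rightarrow> (nat \<times> ('j \<times> nat) option \<Rightarrow> (nat ^ 'j) + 'j option) \<Rightarrow> nat ^ 'j::finite" where
  "population D y = (\<chi> k. card {(i, j, l). i \<in> D \<and> l < projl (y (i, None)) $ j \<and> y (i, Some (j, l)) = Inr (Some k)})"

lemma population_measurable:
  assumes "D \<times> UNIV \<subseteq> I"
  shows "population D \<in> measurable (\<Pi>\<^sub>M x\<in>I. count_space UNIV) (count_space (UNIV :: (nat ^ 'j::finite) set))"
  unfolding population_def
proof (rule measurable_vec_card)
  fix k :: 'j and z :: "nat \<times> 'j \<times> nat"
  obtain i j l where z: "z = (i, j, l)" by (cases z) auto
  let ?M = "\<Pi>\<^sub>M x\<in>I. count_space UNIV :: (nat ^ 'j + 'j option) measure"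
  show "{y \<in> space ?M. z \<in> {(i, j, l). i \<in> D \<and> l < projl (y (i, None)) $ j \<and> y (i, Some (j, l)) = Inr (Some k)}} \<in> sets ?M"
  proof (cases "i \<in> D")
    case True
    have "(\<lambda>y. y (i, c)) \<in> measurable ?M (count_space UNIV)" for c
      using assms True by (intro measurable_component_singleton) auto
    then have "(\<lambda>y. y (i, None)) -` {s. l < projl s $ j} \<inter> space ?M \<in> sets ?M"
      "(\<lambda>y. y (i, Some (j, l))) -` {Inr (Some k)} \<inter> space ?M \<in> sets ?M"
      by (auto intro: measurable_sets)
    then have "((\<lambda>y. y (i, None)) -` {s. l < projl s $ j} \<inter> space ?M) \<inter> ((\<lambda>y. y (i, Some (j, l))) -` {Inr (Some k)} \<inter> space ?M) \<in> sets ?M"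
      by (rule sets.Int)
    also have "((\<lambda>y. y (i, None)) -` {s. l < projl s $ j} \<inter> space ?M) \<inter> ((\<lambda>y. y (i, Some (j, l))) -` {Inr (Some k)} \<inter> space ?M)
      = {y \<in> space ?M. z \<in> {(i, j, l). i \<in> D \<and> l < projl (y (i, None)) $ j \<and> y (i, Some (j, l)) = Inr (Some k)}}"
      using True by (auto simp: z)
    finally show ?thesis .
  qed (simp add: z)
qed

lemma population_cong:
  assumes "\<And>i c. i \<in> D \<Longrightarrow> y (i, c) = y' (i, c)"
  shows "population D y = population D y'"
  using assms unfolding population_def by (auto intro!: arg_cong[where f=card] simp: vec_eq_iff)

lemma finite_population_set:
  fixes s :: "nat \<Rightarrow> nat ^ 'j::finite"
  assumes "finite D"
  shows "finite {(i, j, l). i \<in> D \<and> l < s i $ j \<and> P i j l}"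
proof (rule finite_subset)
  show "{(i, j, l). i \<in> D \<and> l < s i $ j \<and> P i j l} \<subseteq> Sigma D (\<lambda>i. Sigma UNIV (\<lambda>j. {..<s i $ j}))" by auto
  show "finite (Sigma D (\<lambda>i. Sigma (UNIV :: 'j set) (\<lambda>j. {..<s i $ j})))"
    by (intro finite_SigmaI assms finite finite_lessThan)
qed

lemma population_Un:
  assumes "finite D" "finite E" "D \<inter> E = {}"
  shows "population (D \<union> E) y = population D y + population E y"
proof -
  have "card {(i, j, l). i \<in> D \<union> E \<and> l < projl (y (i, None)) $ j \<and> y (i, Some (j, l)) = Inr (Some k)} =
    card {(i, j, l). i \<in> D \<and> l < projl (y (i, None)) $ j \<and> y (i, Some (j, l)) = Inr (Some k)} +
    card {(i, j, l). i \<in> E \<and> l < projl (y (i, None)) $ j \<and> y (i, Some (j, l)) = Inr (Some k)}" for k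
  proof (subst card_Un_disjoint[symmetric])
    show "finite {(i, j, l). i \<in> D \<and> l < projl (y (i, None)) $ j \<and> y (i, Some (j, l)) = Inr (Some k)}"
      "finite {(i, j, l). i \<in> E \<and> l < projl (y (i, None)) $ j \<and> y (i, Some (j, l)) = Inr (Some k)}"
      by (rule finite_population_set[where s="\<lambda>i. projl (y (i, None))"]; fact)+
  qed (use assms in \<open>auto intro!: arg_cong[where f=card]\<close>)
  then show ?thesis by (simp add: population_def vec_eq_iff)
qed

lemma population_Suc:
  "population (Suc ` D) y = population D (\<lambda>(i, c). y (Suc i, c))"
proof -
  have "card {(i, j, l). i \<in> Suc ` D \<and> l < projl (y (i, None)) $ j \<and> y (i, Some (j, l)) = Inr (Some k)} =
    card {(i, j, l). i \<in> D \<and> l < projl (y (Suc i, None)) $ j \<and> y (Suc i, Some (j, l)) = Inr (Some k)}" for k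
    by (rule bij_betw_same_card[of "\<lambda>(i, j, l). (i - 1, j, l)"], rule bij_betw_byWitness[where f'="\<lambda>(i, j, l). (Suc i, j, l)"]) auto
  then show ?thesis by (simp add: population_def vec_eq_iff)
qed

lemma arrival_times_case_nat:
  "arrival_times (case_nat s g) 0 = s" "arrival_times (case_nat s g) (Suc i) = s + arrival_times g i"
  by (simp_all add: arrival_times_def sum.atMost_Suc_shift del: sum.atMost_Suc)

lemma arrived_case_nat:
  assumes "u \<ge> 0"
  shows "{i. arrival_times (case_nat 0 g) i \<le> u} = {0} \<union> Suc ` {i. arrival_times g i \<le> u}"
proof (rule set_eqI)
  fix i show "i \<in> {i. arrival_times (case_nat 0 g) i \<le> u} \<longleftrightarrow> i \<in> {0} \<union> Suc ` {i. arrival_times g i \<le> u}"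
    using assms by (cases i) (auto simp: arrival_times_case_nat)
qed

context infinite_server_network
begin

lemma queue_lengths_eq_population:
  "queue_lengths (\<lambda>i _. \<tau> i) S X t \<omega> = population {i. \<tau> i \<le> t} (\<lambda>x. mark 0 (\<lambda>i. max 0 (t - \<tau> i)) x \<omega>)"
  by (auto simp: queue_lengths_def population_def vec_eq_iff max_def intro!: arg_cong[where f=card])

lemma marks_measurable:
  assumes a: "\<And>i. a i \<ge> 0"
  shows "(\<lambda>\<omega> x. mark m a x \<omega>) \<in> measurable M (\<Pi>\<^sub>M x\<in>UNIV. count_space UNIV)"
proof -
  have rv: "mark m a x \<in> measurable M (count_space UNIV)" for x
    using conjunct1[OF iffD1[OF indep_vars_def2 indep_marks[of a m, OF a]]] by (rule bspec) (rule UNIV_I)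
  show ?thesis by (rule measurable_PiM_single') (use rv in auto)
qed

text \<open>
  Batch \<open>0\<close> stands for an arbitrary batch; all of them have the same law.
\<close>

definition survivors :: "real \<Rightarrow> 'a \<Rightarrow> nat ^ 'j" where
  "survivors u \<omega> = population {0} (\<lambda>x. mark 0 (\<lambda>_. u) x \<omega>)"

definition occupation :: "real \<Rightarrow> real" where
  "occupation u = prob {\<omega> \<in> space M. survivors u \<omega> \<noteq> 0}"

text \<open>
  The expectation of \<open>f\<close> of the queue lengths at time \<open>t\<close> when the arrival times are frozen to those with
  the interarrival times \<open>g\<close>, and only batch sizes and movements are random.
\<close>

definition expect_given_gaps :: "(nat ^ 'j \<Rightarrow> real) \<Rightarrow> real \<Rightarrow> (nat \<Rightarrow> real) \<Rightarrow> real" where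
  "expect_given_gaps f t g = expectation (\<lambda>\<omega>. f (queue_lengths (\<lambda>i _. arrival_times g i) S X t \<omega>))"

lemma population_marks_measurable:
  assumes a: "\<And>i. a i \<ge> 0"
  shows "(\<lambda>\<omega>. population D (\<lambda>x. mark m a x \<omega>)) \<in> measurable M (count_space UNIV)"
  by (rule measurable_compose[OF marks_measurable[of a, OF a] population_measurable]) auto

lemma survivors_measurable: "u \<ge> 0 \<Longrightarrow> survivors u \<in> measurable M (count_space UNIV)"
  unfolding survivors_def by (rule population_marks_measurable)

lemma integrable_bounded_fun:
  assumes "N \<in> measurable M (count_space UNIV)" "\<And>n. \<bar>f n :: real\<bar> \<le> C"
  shows "integrable M (\<lambda>\<omega>. f (N \<omega>))"
proof (rule integrable_const_bound[where B=C])
  show "(\<lambda>\<omega>. f (N \<omega>)) \<in> borel_measurable M"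
    by (rule measurable_compose[OF assms(1)]) auto
qed (use assms(2) in auto)

text \<open>
  The sequence \<open>case_nat 0 g\<close> describes the same arrival times as \<open>g\<close> and one more batch at time \<open>0\<close>, whose
  age at time \<open>u\<close> is \<open>u\<close>. The batches of the old configuration are renumbered from \<open>1\<close> to make room for the
  new one; by shift invariance this does not alter the law of their contribution \<open>R\<close>, and they are
  independent of batch \<open>0\<close>. Finiteness is needed because cardinalities of infinite sets do not add up.
\<close>

lemma extra_batch:
  assumes u: "u \<ge> 0" and fin: "finite {i. arrival_times g i \<le> u}"
  shows "\<exists>R. R \<in> measurable M (count_space UNIV) \<and> indep_var (count_space UNIV) (survivors u) (count_space UNIV) R \<and>
     (\<forall>f :: nat ^ 'j \<Rightarrow> real. expect_given_gaps f u (case_nat 0 g) = expectation (\<lambda>\<omega>. f (survivors u \<omega> + R \<omega>)) \<and>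
          expect_given_gaps f u g = expectation (\<lambda>\<omega>. f (R \<omega>)))"
proof -
  let ?D = "{i. arrival_times g i \<le> u}"
  define a where "a i = max 0 (u - arrival_times g i)" for i
  define a' where "a' = case_nat u a"
  have a0: "a i \<ge> 0" for i by (simp add: a_def)
  have a'0: "a' i \<ge> 0" for i using u by (cases i) (auto simp: a'_def a0)
  define R where "R \<omega> = population (Suc ` ?D) (\<lambda>x. mark 0 a' x \<omega>)" for \<omega>
  have R1: "R \<omega> = population ?D (\<lambda>x. mark 1 a x \<omega>)" for \<omega>
  proof -
    have "mark 0 a' (Suc i, c) \<omega> = mark 1 a (i, c) \<omega>" for i c
      by (cases "(1::nat, a, (i, c), \<omega>)" rule: mark.cases) (auto simp: a'_def)
    then show ?thesis unfolding R_def population_Suc by (intro population_cong) simp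
  qed
  have surv: "survivors u \<omega> = population {0} (\<lambda>x. mark 0 a' x \<omega>)" for \<omega>
    unfolding survivors_def
  proof (rule population_cong)
    fix i and c :: "('j \<times> nat) option" assume "i \<in> {0::nat}"
    then show "mark 0 (\<lambda>_. u) (i, c) \<omega> = mark 0 a' (i, c) \<omega>"
      by (cases c) (auto simp: a'_def)
  qed
  have meas: "R \<in> measurable M (count_space UNIV)"
    unfolding R_def by (rule population_marks_measurable[OF a'0])
  have ind: "indep_var (count_space UNIV) (survivors u) (count_space UNIV) R"
  proof -
    let ?A = "{0::nat} \<times> (UNIV :: ('j \<times> nat) option set)" and ?B = "(- {0::nat}) \<times> (UNIV :: ('j \<times> nat) option set)"
    have "indep_var (PiM ?A (\<lambda>_. count_space UNIV)) (\<lambda>\<omega>. restrict (\<lambda>x. mark 0 a' x \<omega>) ?A)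
        (PiM ?B (\<lambda>_. count_space UNIV)) (\<lambda>\<omega>. restrict (\<lambda>x. mark 0 a' x \<omega>) ?B)"
      by (rule indep_var_restrict[OF indep_marks[of a' 0, OF a'0]]) auto
    then have "indep_var (count_space UNIV) (population {0} \<circ> (\<lambda>\<omega>. restrict (\<lambda>x. mark 0 a' x \<omega>) ?A))
        (count_space UNIV) (population (Suc ` ?D) \<circ> (\<lambda>\<omega>. restrict (\<lambda>x. mark 0 a' x \<omega>) ?B))"
      by (rule indep_var_compose) (rule population_measurable; auto)+
    also have "population {0} \<circ> (\<lambda>\<omega>. restrict (\<lambda>x. mark 0 a' x \<omega>) ?A) = survivors u"
      unfolding surv comp_def by (intro ext population_cong) auto
    also have "population (Suc ` ?D) \<circ> (\<lambda>\<omega>. restrict (\<lambda>x. mark 0 a' x \<omega>) ?B) = R"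
      unfolding R_def comp_def by (intro ext population_cong) auto
    finally show ?thesis .
  qed
  have new: "queue_lengths (\<lambda>i _. arrival_times (case_nat 0 g) i) S X u \<omega> = survivors u \<omega> + R \<omega>" for \<omega>
  proof -
    have "(\<lambda>i. max 0 (u - arrival_times (case_nat 0 g) i)) = a'"
    proof
      fix i show "max 0 (u - arrival_times (case_nat 0 g) i) = a' i"
        using u by (cases i) (auto simp: a'_def a_def arrival_times_case_nat)
    qed
    then have "queue_lengths (\<lambda>i _. arrival_times (case_nat 0 g) i) S X u \<omega> = population ({0} \<union> Suc ` ?D) (\<lambda>x. mark 0 a' x \<omega>)"
      unfolding queue_lengths_eq_population arrived_case_nat[OF u] by simp
    also have "\<dots> = survivors u \<omega> + R \<omega>"
      unfolding surv R_def by (rule population_Un) (use fin in auto)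
    finally show ?thesis .
  qed
  have old: "expect_given_gaps f u g = expectation (\<lambda>\<omega>. f (R \<omega>))" for f
  proof -
    have E: "expectation (\<lambda>\<omega>. f (population ?D (\<lambda>x. mark m a x \<omega>))) =
        (\<integral>y. f (population ?D y) \<partial>distr M (\<Pi>\<^sub>M x\<in>UNIV. count_space UNIV) (\<lambda>\<omega> x. mark m a x \<omega>))" for m
      by (rule integral_distr[symmetric, OF marks_measurable[of a, OF a0]])
         (rule measurable_compose[OF population_measurable], auto)
    have "expect_given_gaps f u g = expectation (\<lambda>\<omega>. f (population ?D (\<lambda>x. mark 0 a x \<omega>)))"
      unfolding expect_given_gaps_def queue_lengths_eq_population a_def ..
    also have "\<dots> = expectation (\<lambda>\<omega>. f (population ?D (\<lambda>x. mark 1 a x \<omega>)))"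
      unfolding E marks_shift_invariant[of a 1, OF a0] ..
    finally show ?thesis unfolding R1 .
  qed
  show ?thesis
    using meas ind new old unfolding expect_given_gaps_def by auto
qed

text \<open>
  The new batch alters the queue lengths only on the event that one of its customers is present.
\<close>

lemma extra_batch_bounded:
  assumes u: "u \<ge> 0" and fin: "finite {i. arrival_times g i \<le> u}" and f: "\<And>n. \<bar>f n\<bar> \<le> C"
  shows "\<bar>expect_given_gaps f u (case_nat 0 g) - expect_given_gaps f u g\<bar> \<le> 2 * C * occupation u"
proof -
  obtain R where R: "R \<in> measurable M (count_space UNIV)"
    and new: "expect_given_gaps f u (case_nat 0 g) = expectation (\<lambda>\<omega>. f (survivors u \<omega> + R \<omega>))"
    and old: "expect_given_gaps f u g = expectation (\<lambda>\<omega>. f (R \<omega>))"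
    using extra_batch[OF u fin] by blast
  note sm = survivors_measurable[OF u]
  have sum: "(\<lambda>\<omega>. survivors u \<omega> + R \<omega>) \<in> measurable M (count_space UNIV)"
    using sm R by measurable
  have i: "integrable M (\<lambda>\<omega>. f (survivors u \<omega> + R \<omega>))" "integrable M (\<lambda>\<omega>. f (R \<omega>))"
    using integrable_bounded_fun[OF sum, of f C] integrable_bounded_fun[OF R, of f C] f by auto
  have A: "{\<omega> \<in> space M. survivors u \<omega> \<noteq> 0} \<in> events" using sm by measurable
  have Ai: "integrable M (indicator {\<omega> \<in> space M. survivors u \<omega> \<noteq> 0} :: 'a \<Rightarrow> real)"
    by (rule integrable_real_indicator[OF A]) (simp add: emeasure_eq_measure)
  have "\<bar>expect_given_gaps f u (case_nat 0 g) - expect_given_gaps f u g\<bar> = \<bar>expectation (\<lambda>\<omega>. f (survivors u \<omega> + R \<omega>) - f (R \<omega>))\<bar>"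
    unfolding new old using i by simp
  also have "\<dots> \<le> expectation (\<lambda>\<omega>. \<bar>f (survivors u \<omega> + R \<omega>) - f (R \<omega>)\<bar>)"
    by (rule integral_abs_bound)
  also have "\<dots> \<le> expectation (\<lambda>\<omega>. 2 * C * indicator {\<omega> \<in> space M. survivors u \<omega> \<noteq> 0} \<omega>)"
  proof (rule integral_mono)
    fix \<omega> assume "\<omega> \<in> space M"
    then show "\<bar>f (survivors u \<omega> + R \<omega>) - f (R \<omega>)\<bar> \<le> 2 * C * indicator {\<omega> \<in> space M. survivors u \<omega> \<noteq> 0} \<omega>"
      using f[of "survivors u \<omega> + R \<omega>"] f[of "R \<omega>"] by (auto simp: indicator_def abs_le_iff)
  qed (use i Ai in auto)
  also have "\<dots> = 2 * C * occupation u" using A by (simp add: occupation_def)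
  finally show ?thesis .
qed

text \<open>
  A function that is positive everywhere, so that its expectation can tend to \<open>0\<close> only if the number of
  customers tends to infinity in probability, and that turns sums into products. Its expectation is the
  probability generating function of the total number of customers at \<open>1 / 2\<close>.
\<close>

definition half_weight :: "nat ^ 'j \<Rightarrow> real" where
  "half_weight n = (1 / 2) ^ (\<Sum>k\<in>UNIV. n $ k)"

lemma half_weight_bounds: "0 < half_weight n" "half_weight n \<le> 1"
  by (auto simp: half_weight_def power_le_one)

text \<open>
  The new batch, if it has a customer present, at least halves \<open>half_weight\<close>, and it is independent of
  all the others.
\<close>

lemma extra_batch_half_weight:
  assumes u: "u \<ge> 0" and fin: "finite {i. arrival_times g i \<le> u}"
  shows "expect_given_gaps half_weight u (case_nat 0 g) \<le> (1 - occupation u / 2) * expect_given_gaps half_weight u g"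
proof -
  obtain R where R: "R \<in> measurable M (count_space UNIV)"
    and ind: "indep_var (count_space UNIV) (survivors u) (count_space UNIV) R"
    and new: "expect_given_gaps half_weight u (case_nat 0 g) = expectation (\<lambda>\<omega>. half_weight (survivors u \<omega> + R \<omega>))"
    and old: "expect_given_gaps half_weight u g = expectation (\<lambda>\<omega>. half_weight (R \<omega>))"
    using extra_batch[OF u fin] by blast
  note sm = survivors_measurable[OF u]
  have b: "\<bar>half_weight n\<bar> \<le> 1" for n using half_weight_bounds[of n] by simp
  have i: "integrable M (\<lambda>\<omega>. half_weight (survivors u \<omega>))" "integrable M (\<lambda>\<omega>. half_weight (R \<omega>))"
    using integrable_bounded_fun[OF sm, of half_weight 1] integrable_bounded_fun[OF R, of half_weight 1] b by auto
  have A: "{\<omega> \<in> space M. survivors u \<omega> \<noteq> 0} \<in> events" using sm by measurable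
  have Ai: "integrable M (indicator {\<omega> \<in> space M. survivors u \<omega> \<noteq> 0} :: 'a \<Rightarrow> real)"
    by (rule integrable_real_indicator[OF A]) (simp add: emeasure_eq_measure)
  have add: "half_weight (m + n) = half_weight m * half_weight n" for m n
    by (simp add: half_weight_def sum.distrib power_add)
  have "indep_var borel (half_weight \<circ> survivors u) borel (half_weight \<circ> R)"
    by (rule indep_var_compose[OF ind]) auto
  then have "expect_given_gaps half_weight u (case_nat 0 g) =
      expectation (\<lambda>\<omega>. half_weight (survivors u \<omega>)) * expect_given_gaps half_weight u g"
    unfolding new old add using indep_var_lebesgue_integral[of "half_weight \<circ> survivors u" "half_weight \<circ> R"] i by (simp add: comp_def)
  moreover have "expectation (\<lambda>\<omega>. half_weight (survivors u \<omega>)) \<le> expectation (\<lambda>\<omega>. 1 - indicator {\<omega> \<in> space M. survivors u \<omega> \<noteq> 0} \<omega> / 2)"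
  proof (rule integral_mono)
    fix \<omega> assume \<omega>: "\<omega> \<in> space M"
    have "half_weight (survivors u \<omega>) \<le> 1 / 2" if "survivors u \<omega> \<noteq> 0"
    proof -
      from that have "(\<Sum>k\<in>UNIV. survivors u \<omega> $ k) \<noteq> 0" by (auto simp: vec_eq_iff)
      then obtain n where "(\<Sum>k\<in>UNIV. survivors u \<omega> $ k) = Suc n" by (cases "\<Sum>k\<in>UNIV. survivors u \<omega> $ k") auto
      then show ?thesis by (simp add: half_weight_def power_le_one)
    qed
    then show "half_weight (survivors u \<omega>) \<le> 1 - indicator {\<omega> \<in> space M. survivors u \<omega> \<noteq> 0} \<omega> / 2"
      using half_weight_bounds(2)[of "survivors u \<omega>"] by (auto simp: indicator_def)
  qed (use i Ai in auto)
  moreover have "expectation (\<lambda>\<omega>. 1 - indicator {\<omega> \<in> space M. survivors u \<omega> \<noteq> 0} \<omega> / 2) = 1 - occupation u / 2"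
    using A Ai by (simp add: occupation_def prob_space)
  moreover have "expect_given_gaps half_weight u g \<ge> 0"
    unfolding old using half_weight_bounds(1) by (intro integral_nonneg_AE) (auto intro: less_imp_le)
  ultimately show ?thesis by (auto intro: mult_right_mono)
qed

lemma prob_departed:
  assumes u: "u \<ge> 0"
  shows "prob {\<omega> \<in> space M. X i j l u \<omega> = None} = 1 - in_network_prob q j u"
proof -
  have lm: "X i j l u \<in> measurable M (count_space UNIV)" using u by (rule location_measurable)
  have "prob {\<omega> \<in> space M. X i j l u \<omega> \<noteq> None} = (\<Sum>k\<in>UNIV. prob {\<omega> \<in> space M. X i j l u \<omega> = Some k})"
  proof -
    have "{\<omega> \<in> space M. X i j l u \<omega> \<noteq> None} = (\<Union>k. {\<omega> \<in> space M. X i j l u \<omega> = Some k})" by auto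
    then show ?thesis
      using lm by (simp only:) (rule finite_measure_finite_Union, auto simp: disjoint_family_on_def)
  qed
  also have "\<dots> = in_network_prob q j u" using location_prob[OF u] by (simp add: in_network_prob_def)
  finally have "prob {\<omega> \<in> space M. X i j l u \<omega> \<noteq> None} = in_network_prob q j u" .
  moreover have "prob {\<omega> \<in> space M. \<not> (X i j l u \<omega> \<noteq> None)} = 1 - prob {\<omega> \<in> space M. X i j l u \<omega> \<noteq> None}"
    by (rule prob_neg) (use lm in measurable)
  ultimately show ?thesis by simp
qed

lemma in_network_prob_bounds:
  assumes u: "u \<ge> 0"
  shows "0 \<le> in_network_prob q j u" "in_network_prob q j u \<le> 1"
  using prob_departed[OF u, of 0 j 0] prob_le_1[of "{\<omega> \<in> space M. X 0 j 0 u \<omega> = None}"]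
    measure_nonneg[of M "{\<omega> \<in> space M. X 0 j 0 u \<omega> = None}"] by linarith+

text \<open>
  Given the sizes \<open>s\<close> of the batch, none of its customers is present at age \<open>u\<close> with probability
  \<open>\<Prod>j. (1 - in_network_prob q j u) ^ (s $ j)\<close>, the locations being independent of each other and of the sizes.
\<close>

lemma occupation_eq:
  assumes u: "u \<ge> 0"
  shows "occupation u = measure_pmf.expectation p (\<lambda>s. 1 - (\<Prod>j\<in>UNIV. (1 - in_network_prob q j u) ^ (s $ j)))"
proof -
  note sm = survivors_measurable[OF u]
  have surv0: "survivors u \<omega> = 0 \<longleftrightarrow> (\<forall>j l. l < S 0 \<omega> $ j \<longrightarrow> X 0 j l u \<omega> = None)" for \<omega>
  proof -
    have fin: "finite {(i, j, l). i \<in> {0::nat} \<and> l < S 0 \<omega> $ j \<and> X 0 j l u \<omega> = Some k}" for k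
      by (rule finite_population_set) simp
    have "survivors u \<omega> $ k = card {(i, j, l). i \<in> {0::nat} \<and> l < S 0 \<omega> $ j \<and> X 0 j l u \<omega> = Some k}" for k
      unfolding survivors_def population_def by (auto intro!: arg_cong[where f=card])
    then have "survivors u \<omega> = 0 \<longleftrightarrow> (\<forall>k. {(i, j, l). i \<in> {0::nat} \<and> l < S 0 \<omega> $ j \<and> X 0 j l u \<omega> = Some k} = {})"
      unfolding card_0_eq[OF fin, symmetric] by (simp only: vec_eq_iff zero_index)
    also have "\<dots> \<longleftrightarrow> (\<forall>j l. l < S 0 \<omega> $ j \<longrightarrow> X 0 j l u \<omega> = None)"
      by (auto) (metis not_None_eq)
    finally show ?thesis .
  qed
  note none = prob_departed[OF u]
  define W where "W s = (\<Prod>j\<in>UNIV. (1 - in_network_prob q j u) ^ (s $ j))" for s :: "nat ^ 'j"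
  define A where "A s = {\<omega> \<in> space M. S 0 \<omega> = s \<and> survivors u \<omega> = 0}" for s
  have probA: "prob (A s) = pmf p s * W s" for s
  proof -
    let ?J = "Sigma UNIV (\<lambda>j. {..<s $ j})"
    define Y where "Y x = (case snd x of None \<Rightarrow> {Inl s} | Some _ \<Rightarrow> {Inr None :: nat ^ 'j + 'j option})" for x :: "nat \<times> ('j \<times> nat) option"
    \<comment> \<open>the marks that decide the event \<open>A s\<close>: the sizes and the locations of the customers of batch \<open>0\<close>\<close>
    let ?J' = "Pair 0 ` insert None (Some ` ?J)"
    have "A s = (\<Inter>x\<in>?J'. mark 0 (\<lambda>_. u) x -` Y x \<inter> space M)"
    proof (rule set_eqI)
      fix \<omega>
      have "(\<forall>x\<in>?J'. mark 0 (\<lambda>_. u) x \<omega> \<in> Y x) \<longleftrightarrow> S 0 \<omega> = s \<and> (\<forall>j l. l < s $ j \<longrightarrow> X 0 j l u \<omega> = None)"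
        by (auto simp: Y_def)
      moreover have "\<omega> \<in> (\<Inter>x\<in>?J'. mark 0 (\<lambda>_. u) x -` Y x \<inter> space M) \<longleftrightarrow>
          \<omega> \<in> space M \<and> (\<forall>x\<in>?J'. mark 0 (\<lambda>_. u) x \<omega> \<in> Y x)"
        by blast
      ultimately show "\<omega> \<in> A s \<longleftrightarrow> \<omega> \<in> (\<Inter>x\<in>?J'. mark 0 (\<lambda>_. u) x -` Y x \<inter> space M)"
        unfolding A_def surv0 by blast
    qed
    also have "prob \<dots> = (\<Prod>x\<in>?J'. prob (mark 0 (\<lambda>_. u) x -` Y x \<inter> space M))"
      by (rule indep_varsD[OF indep_marks]) (use u in auto)
    also have "\<dots> = prob (S 0 -` {s} \<inter> space M) * (\<Prod>(j, l)\<in>?J. prob {\<omega> \<in> space M. X 0 j l u \<omega> = None})"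
    proof -
      have split: "(\<Prod>x\<in>?J'. h x) = h (0, None) * (\<Prod>z\<in>?J. h (0, Some z))" for h :: "_ \<Rightarrow> real"
      proof -
        have "(\<Prod>x\<in>?J'. h x) = (\<Prod>c\<in>insert None (Some ` ?J). h (0, c))"
          by (subst prod.reindex) (auto simp: inj_on_def)
        also have "\<dots> = h (0, None) * (\<Prod>c\<in>Some ` ?J. h (0, c))"
          by (subst prod.insert) auto
        also have "(\<Prod>c\<in>Some ` ?J. h (0, c)) = (\<Prod>z\<in>?J. h (0, Some z))"
          by (subst prod.reindex) auto
        finally show ?thesis .
      qed
      show ?thesis
        unfolding split
      proof (intro arg_cong2[where f="(*)"] prod.cong refl)
        show "prob (mark 0 (\<lambda>_. u) (0, None) -` Y (0, None) \<inter> space M) = prob (S 0 -` {s} \<inter> space M)"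
          by (rule arg_cong[where f=prob]) (auto simp: Y_def)
        fix z :: "'j \<times> nat"
        show "prob (mark 0 (\<lambda>_. u) (0, Some z) -` Y (0, Some z) \<inter> space M) =
            (case z of (j, l) \<Rightarrow> prob {\<omega> \<in> space M. X 0 j l u \<omega> = None})"
          by (cases z) (auto simp: Y_def intro!: arg_cong[where f=prob])
      qed
    qed
    also have "prob (S 0 -` {s} \<inter> space M) = pmf p s"
      using batch_distr[of 0] batch_measurable[of 0] by (simp add: pmf.rep_eq flip: measure_distr)
    also have "(\<Prod>(j, l)\<in>?J. prob {\<omega> \<in> space M. X 0 j l u \<omega> = None}) = W s"
      unfolding none by (subst prod.Sigma[symmetric]) (auto simp: W_def)
    finally show ?thesis .
  qed
  have W: "0 \<le> W s" "W s \<le> 1" for s unfolding W_def using in_network_prob_bounds[OF u] by (auto intro!: prod_nonneg prod_le_1 power_le_one)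
  have Wi: "integrable (measure_pmf p) W"
    by (rule measure_pmf.integrable_const_bound[where B=1]) (use W in auto)
  have Am: "A s \<in> events" for s
    unfolding A_def using sm batch_measurable[of 0] by measurable
  have "ennreal (prob {\<omega> \<in> space M. survivors u \<omega> = 0}) = emeasure M (\<Union>s. A s)"
    unfolding emeasure_eq_measure[symmetric] by (rule arg_cong[where f="emeasure M"]) (auto simp: A_def)
  also have "\<dots> = (\<integral>\<^sup>+s. emeasure M (A s) \<partial>count_space UNIV)"
    by (rule emeasure_UN_countable) (use Am in \<open>auto simp: disjoint_family_on_def A_def\<close>)
  also have "\<dots> = (\<integral>\<^sup>+s. ennreal (W s) \<partial>measure_pmf p)"
    unfolding nn_integral_measure_pmf by (simp add: emeasure_eq_measure probA ennreal_mult W)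
  also have "\<dots> = ennreal (measure_pmf.expectation p W)"
    by (rule nn_integral_eq_integral[OF Wi]) (simp add: W)
  finally have "prob {\<omega> \<in> space M. survivors u \<omega> = 0} = measure_pmf.expectation p W"
    using W by (simp add: integral_nonneg_AE)
  moreover have "prob {\<omega> \<in> space M. \<not> survivors u \<omega> = 0} = 1 - prob {\<omega> \<in> space M. survivors u \<omega> = 0}"
    by (rule prob_neg) (use sm in measurable)
  ultimately show ?thesis
    using Wi unfolding occupation_def W_def[symmetric] by simp
qed

end

section \<open>Interarrival times and conditioning\<close>

text \<open>
  The sequences of interarrival times for which only finitely many batches arrive up to any given time.
  Comparison with natural numbers suffices and keeps the condition countable, hence measurable.
\<close>

definition regular_gaps :: "(nat \<Rightarrow> real) \<Rightarrow> bool" where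
  "regular_gaps g \<longleftrightarrow> (\<forall>i. g i \<ge> 0) \<and> (\<forall>n::nat. \<exists>i. arrival_times g i > real n)"

lemma regular_gaps_finite:
  assumes "regular_gaps g" shows "finite {i. arrival_times g i \<le> t}"
proof -
  have nn: "g i \<ge> 0" for i using assms by (simp add: regular_gaps_def)
  obtain n :: nat where n: "t \<le> real n" using real_arch_simple by blast
  obtain i0 where i0: "arrival_times g i0 > real n" using assms unfolding regular_gaps_def by blast
  have "i < i0" if "arrival_times g i \<le> t" for i
  proof (rule ccontr)
    assume "\<not> i < i0"
    then have "arrival_times g i0 \<le> arrival_times g i"
      unfolding arrival_times_def by (intro sum_mono2) (auto simp: nn)
    then show False using that i0 n by linarith
  qed
  then have "{i. arrival_times g i \<le> t} \<subseteq> {..<i0}" by auto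
  then show ?thesis by (rule finite_subset) simp
qed

lemma arrival_times_measurable[measurable]:
  "(\<lambda>g. arrival_times g i) \<in> borel_measurable (\<Pi>\<^sub>M i\<in>UNIV. borel)"
  unfolding arrival_times_def by measurable

context infinite_server_network
begin

text \<open>
  The arrival times and the current time are parameters here, which covers random arrival times as well
  as frozen ones and the dependence of expectations on time.
\<close>

lemma queue_lengths_measurable:
  assumes S: "\<And>i. S i \<in> measurable G (count_space UNIV)"
    and X: "\<And>i j l. (\<lambda>(t, \<omega>). X i j l t \<omega>) \<in> measurable (restrict_space borel {0..} \<Otimes>\<^sub>M G) (count_space UNIV)"
    and \<tau>: "\<And>i. \<tau> i \<in> borel_measurable K" and t: "t \<in> borel_measurable K" and w: "w \<in> measurable K G"
  shows "(\<lambda>x. queue_lengths (\<lambda>i _. \<tau> i x) S X (t x) (w x)) \<in> measurable K (count_space UNIV)"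
  unfolding queue_lengths_def
proof (rule measurable_vec_card)
  fix k :: 'j and z :: "nat \<times> 'j \<times> nat"
  obtain i j l where z: "z = (i, j, l)" by (cases z) auto
  have 1: "{x \<in> space K. \<tau> i x \<le> t x} \<in> sets K"
    using \<tau> t by (rule borel_measurable_le)
  have 2: "(\<lambda>x. S i (w x)) -` {s. l < s $ j} \<inter> space K \<in> sets K"
    by (rule measurable_sets[OF measurable_compose[OF w S]]) simp
  have "(\<lambda>x. max 0 (t x - \<tau> i x)) \<in> measurable K (restrict_space borel {0..})"
    by (rule measurable_restrict_space2) (auto intro!: borel_measurable_max borel_measurable_diff \<tau> t)
  then have "(\<lambda>x. (max 0 (t x - \<tau> i x), w x)) \<in> measurable K (restrict_space borel {0..} \<Otimes>\<^sub>M G)"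
    by (rule measurable_Pair[OF _ w])
  from measurable_sets[OF measurable_compose[OF this X[of i j l]], of "{Some k}"]
  have 3: "(\<lambda>x. X i j l (max 0 (t x - \<tau> i x)) (w x)) -` {Some k} \<inter> space K \<in> sets K"
    by simp
  have "{x \<in> space K. z \<in> {(i, j, l). \<tau> i x \<le> t x \<and> l < S i (w x) $ j \<and> X i j l (t x - \<tau> i x) (w x) = Some k}}
    = {x \<in> space K. \<tau> i x \<le> t x} \<inter> ((\<lambda>x. S i (w x)) -` {s. l < s $ j} \<inter> space K)
      \<inter> ((\<lambda>x. X i j l (max 0 (t x - \<tau> i x)) (w x)) -` {Some k} \<inter> space K)"
    by (auto simp: z max_def)
  also have "\<dots> \<in> sets K" by (intro sets.Int 1 2 3)
  finally show "{x \<in> space K. z \<in> {(i, j, l). \<tau> i x \<le> t x \<and> l < S i (w x) $ j \<and> X i j l (t x - \<tau> i x) (w x) = Some k}} \<in> sets K" .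
qed

lemma jointly_measurable_locations:
  "(\<lambda>(t, \<omega>). X i j l t \<omega>) \<in> measurable (restrict_space borel {0..} \<Otimes>\<^sub>M M) (count_space UNIV)"
proof -
  obtain G where G: "subalgebra M G"
    "(\<lambda>(t, \<omega>). X i j l t \<omega>) \<in> measurable (restrict_space borel {0..} \<Otimes>\<^sub>M G) (count_space UNIV)"
    using sigma_algebra_without_arrivals by blast
  have idm: "(\<lambda>\<omega>. \<omega>) \<in> measurable M G"
    by (rule measurable_from_subalg[OF G(1)]) simp
  have "(\<lambda>x. (fst x, snd x)) \<in> measurable (restrict_space borel {0..} \<Otimes>\<^sub>M M) (restrict_space borel {0..} \<Otimes>\<^sub>M G)"
    by (intro measurable_Pair measurable_fst measurable_compose[OF measurable_snd idm])
  from measurable_compose[OF this G(2)] show ?thesis by (simp add: case_prod_unfold)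
qed

definition gap_law :: "real measure" where
  "gap_law = density lborel (\<lambda>x. ennreal (exponential_density rate x))"

definition gaps_law :: "(nat \<Rightarrow> real) measure" where
  "gaps_law = (\<Pi>\<^sub>M i\<in>UNIV. gap_law)"

lemma gap_law_sets[measurable_cong]: "sets gap_law = sets borel"
  by (simp add: gap_law_def)

lemma gaps_law_sets[measurable_cong]: "sets gaps_law = sets (\<Pi>\<^sub>M i\<in>UNIV. borel)"
  unfolding gaps_law_def by (intro sets_PiM_cong refl gap_law_sets)

lemma gap_law_prob_space: "prob_space gap_law"
  unfolding gap_law_def using prob_space_exponential_density[OF rate_pos] .

lemma gaps_law_prob_space: "prob_space gaps_law"
  unfolding gaps_law_def by (intro prob_space_PiM gap_law_prob_space)

lemma gap_distributed: "distributed M lborel (gap T i) (exponential_density rate)"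
  using arrivals by (simp add: poisson_points_def)

lemma gap_measurable[measurable]: "gap T i \<in> borel_measurable M"
  using distributed_measurable[OF gap_distributed] by simp

lemma gaps_indep: "indep_vars (\<lambda>_. borel) (gap T) UNIV"
  using arrivals by (simp add: poisson_points_def)

lemma arrival_times_gap: "arrival_times (\<lambda>i. gap T i \<omega>) i = T i \<omega>"
  unfolding arrival_times_def by (induction i) (auto simp: gap_def)

lemma T_measurable[measurable]: "T i \<in> borel_measurable M"
proof -
  have "(\<lambda>\<omega>. \<Sum>m\<le>i. gap T m \<omega>) \<in> borel_measurable M" by measurable
  also have "(\<lambda>\<omega>. \<Sum>m\<le>i. gap T m \<omega>) = T i"
    using arrival_times_gap[of _ i] by (intro ext) (simp add: arrival_times_def)
  finally show ?thesis .
qed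

lemma gaps_distr: "distr M (\<Pi>\<^sub>M i\<in>UNIV. borel) (\<lambda>\<omega> i. gap T i \<omega>) = gaps_law"
proof -
  have "UNIV \<noteq> ({} :: nat set)" by (rule UNIV_not_empty)
  from iffD1[OF indep_vars_iff_distr_eq_PiM[where M'="\<lambda>_. borel", OF this gap_measurable] gaps_indep]
  have "distr M (\<Pi>\<^sub>M i\<in>UNIV. borel) (\<lambda>\<omega> i. gap T i \<omega>) = (\<Pi>\<^sub>M i\<in>UNIV. distr M borel (gap T i))"
    unfolding restrict_UNIV .
  also have "\<dots> = gaps_law"
    unfolding gaps_law_def
  proof (rule PiM_cong[OF refl])
    fix i
    have "distr M borel (gap T i) = distr M lborel (gap T i)" by (rule distr_cong) auto
    then show "distr M borel (gap T i) = gap_law"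
      using distributed_distr_eq_density[OF gap_distributed] by (simp add: gap_law_def)
  qed
  finally show ?thesis .
qed

text \<open>
  The \<open>i\<close>-th arrival time is a sum of \<open>i + 1\<close> exponential variables. The probability that it is at most \<open>n\<close>
  is the tail of the exponential series at \<open>rate * n\<close>, divided by \<open>exp (rate * n)\<close>, and thus tends to \<open>0\<close>.
\<close>

lemma arrivals_diverge: "AE \<omega> in M. \<forall>n::nat. \<exists>i. T i \<omega> > real n"
  unfolding AE_all_countable
proof
  fix n :: nat
  have prob_le: "prob {\<omega> \<in> space M. T i \<omega> \<le> real n} = erlang_CDF i rate (real n)" for i
  proof -
    have "distributed M lborel (\<lambda>\<omega>. \<Sum>m\<in>{..i}. gap T m \<omega>) (erlang_density (card {..i} - 1) rate)"
      by (rule exponential_distributed_sum[OF finite_atMost _ rate_pos gap_distributed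
            indep_vars_subset[OF gaps_indep subset_UNIV]]) simp
    then have "distributed M lborel (T i) (erlang_density i rate)"
      using arrival_times_gap[of _ i] by (simp add: arrival_times_def)
    then show ?thesis by (rule erlang_distributed_le) (use rate_pos in auto)
  qed
  have "(\<lambda>i. \<Sum>m\<le>i. (rate * real n) ^ m / fact m) \<longlonglongrightarrow> exp (rate * real n)"
    using exp_converges[of "rate * real n"] unfolding sums_def_le by (simp add: divide_inverse mult.commute)
  then have "(\<lambda>i. 1 - exp (- rate * real n) * (\<Sum>m\<le>i. (rate * real n) ^ m / fact m)) \<longlonglongrightarrow> 1 - exp (- rate * real n) * exp (rate * real n)"
    by (intro tendsto_intros)
  moreover have "erlang_CDF i rate (real n) = 1 - exp (- rate * real n) * (\<Sum>m\<le>i. (rate * real n) ^ m / fact m)" for i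
    by (simp add: erlang_CDF_def sum_distrib_left mult.commute)
  ultimately have lim: "(\<lambda>i. erlang_CDF i rate (real n)) \<longlonglongrightarrow> 0"
    by (simp flip: exp_add)
  have "prob {\<omega> \<in> space M. \<forall>i. T i \<omega> \<le> real n} \<le> 0"
  proof (rule LIMSEQ_le_const[OF lim], intro exI allI impI)
    fix i :: nat
    show "prob {\<omega> \<in> space M. \<forall>i. T i \<omega> \<le> real n} \<le> erlang_CDF i rate (real n)"
      unfolding prob_le[symmetric] by (rule finite_measure_mono) auto
  qed
  then have "prob {\<omega> \<in> space M. \<forall>i. T i \<omega> \<le> real n} = 0" by (simp add: measure_le_0_iff)
  then show "AE \<omega> in M. \<exists>i. T i \<omega> > real n"
    by (intro AE_I[where N="{\<omega> \<in> space M. \<forall>i. T i \<omega> \<le> real n}"]) (auto simp: emeasure_eq_measure not_less)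
qed

lemma AE_gap_law_nonneg: "AE s in gap_law. s \<ge> 0"
  unfolding gap_law_def by (subst AE_density) (auto simp: exponential_density_def intro!: AE_I2)

lemma AE_regular_gaps: "AE g in gaps_law. regular_gaps g"
proof -
  have gm: "(\<lambda>\<omega> i. gap T i \<omega>) \<in> measurable M (\<Pi>\<^sub>M i\<in>UNIV. borel)"
    by (rule measurable_PiM_single') auto
  have "AE g in gaps_law. \<forall>n::nat. \<exists>i. arrival_times g i > real n"
    unfolding gaps_distr[symmetric]
    by (subst AE_distr_iff[OF gm]) (measurable, simp add: arrival_times_gap arrivals_diverge)
  moreover have "AE g in gaps_law. \<forall>i. g i \<ge> 0"
    unfolding AE_all_countable gaps_law_def
    by (intro allI AE_PiM_component gap_law_prob_space AE_gap_law_nonneg) auto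
  ultimately show ?thesis by eventually_elim (simp add: regular_gaps_def)
qed

text \<open>
  Conditioning on the arrival times: they are independent of the \<open>\<sigma>\<close>-algebra of all other randomness, so
  the joint law of the two is a product and Fubini applies. To view the other randomness as a random
  variable, the identity on outcomes is used.
\<close>

lemma expectation_eq_gaps:
  assumes f: "\<And>n. \<bar>f n :: real\<bar> \<le> C"
  shows "expectation (\<lambda>\<omega>. f (queue_lengths T S X t \<omega>)) = (\<integral>g. expect_given_gaps f t g \<partial>gaps_law)"
proof -
  obtain G where G: "subalgebra M G" "\<And>i. S i \<in> measurable G (count_space UNIV)"
    "\<And>i j l. (\<lambda>(t, \<omega>). X i j l t \<omega>) \<in> measurable (restrict_space borel {0..} \<Otimes>\<^sub>M G) (count_space UNIV)"
    "indep_set (sets (vimage_algebra (space M) (\<lambda>\<omega> i. T i \<omega>) (Pi\<^sub>M UNIV (\<lambda>_. borel)))) (sets G)"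
    using sigma_algebra_without_arrivals by blast
  let ?P = "\<Pi>\<^sub>M i\<in>UNIV. borel :: real measure"
  have spG: "space G = space M" using G(1) by (simp add: subalgebra_def)
  have Tm: "(\<lambda>\<omega> i. T i \<omega>) \<in> measurable M ?P" by (rule measurable_PiM_single') auto
  have idm: "(\<lambda>\<omega>. \<omega>) \<in> measurable M G" by (rule measurable_from_subalg[OF G(1)]) simp
  interpret DT: prob_space "distr M ?P (\<lambda>\<omega> i. T i \<omega>)" by (rule prob_space_distr[OF Tm])
  interpret DG: prob_space "distr M G (\<lambda>\<omega>. \<omega>)" by (rule prob_space_distr[OF idm])
  interpret DD: pair_prob_space "distr M ?P (\<lambda>\<omega> i. T i \<omega>)" "distr M G (\<lambda>\<omega>. \<omega>)" ..
  have joint: "distr M ?P (\<lambda>\<omega> i. T i \<omega>) \<Otimes>\<^sub>M distr M G (\<lambda>\<omega>. \<omega>) = distr M (?P \<Otimes>\<^sub>M G) (\<lambda>\<omega>. (\<lambda>i. T i \<omega>, \<omega>))"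
  proof (rule pair_measure_eqI)
    fix A B assume A: "A \<in> sets (distr M ?P (\<lambda>\<omega> i. T i \<omega>))" and B: "B \<in> sets (distr M G (\<lambda>\<omega>. \<omega>))"
    have B': "B \<in> sets G" "B \<subseteq> space M" using B sets.sets_into_space[of B G] by (auto simp: spG)
    let ?a = "(\<lambda>\<omega> i. T i \<omega>) -` A \<inter> space M"
    have "?a \<in> sets (vimage_algebra (space M) (\<lambda>\<omega> i. T i \<omega>) ?P)"
      using A by (intro in_vimage_algebra) simp
    then have "prob (?a \<inter> B) = prob ?a * prob B" by (rule indep_setD[OF G(4) _ B'(1)])
    moreover have "(\<lambda>\<omega>. (\<lambda>i. T i \<omega>, \<omega>)) -` (A \<times> B) \<inter> space M = ?a \<inter> B"
      "(\<lambda>\<omega>. \<omega>) -` B \<inter> space M = B" using B'(2) by auto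
    moreover have "(\<lambda>\<omega>. (\<lambda>i. T i \<omega>, \<omega>)) \<in> measurable M (?P \<Otimes>\<^sub>M G)" by (intro measurable_Pair Tm idm)
    ultimately show "emeasure (distr M ?P (\<lambda>\<omega> i. T i \<omega>)) A * emeasure (distr M G (\<lambda>\<omega>. \<omega>)) B =
        emeasure (distr M (?P \<Otimes>\<^sub>M G) (\<lambda>\<omega>. (\<lambda>i. T i \<omega>, \<omega>))) (A \<times> B)"
      using A B Tm idm by (simp add: emeasure_distr emeasure_eq_measure ennreal_mult)
  qed (simp_all add: DT.sigma_finite_measure_axioms DG.sigma_finite_measure_axioms cong: sets_pair_measure_cong)
  define \<Phi> where "\<Phi> = (\<lambda>(\<tau>, \<omega>). f (queue_lengths (\<lambda>i _. \<tau> i) S X t \<omega>))"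
  have \<Phi>m: "\<Phi> \<in> borel_measurable (?P \<Otimes>\<^sub>M G)"
  proof -
    have "(\<lambda>x. queue_lengths (\<lambda>i _. fst x i) S X t (snd x)) \<in> measurable (?P \<Otimes>\<^sub>M G) (count_space UNIV)"
      by (rule queue_lengths_measurable[OF G(2,3)]) auto
    from measurable_compose[OF this, of f borel] show ?thesis by (simp add: \<Phi>_def case_prod_unfold)
  qed
  have "expectation (\<lambda>\<omega>. f (queue_lengths T S X t \<omega>)) = expectation (\<lambda>\<omega>. \<Phi> (\<lambda>i. T i \<omega>, \<omega>))"
    by (simp add: \<Phi>_def queue_lengths_def)
  also have "\<dots> = (\<integral>x. \<Phi> x \<partial>distr M (?P \<Otimes>\<^sub>M G) (\<lambda>\<omega>. (\<lambda>i. T i \<omega>, \<omega>)))"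
    by (rule integral_distr[OF measurable_Pair[OF Tm idm] \<Phi>m, symmetric])
  also have "\<dots> = (\<integral>\<tau>. \<integral>\<omega>. \<Phi> (\<tau>, \<omega>) \<partial>distr M G (\<lambda>\<omega>. \<omega>) \<partial>distr M ?P (\<lambda>\<omega> i. T i \<omega>))"
  proof -
    have "integrable (distr M ?P (\<lambda>\<omega> i. T i \<omega>) \<Otimes>\<^sub>M distr M G (\<lambda>\<omega>. \<omega>)) \<Phi>"
    proof (rule DD.P.integrable_const_bound[where B=C])
      have "sets (distr M ?P (\<lambda>\<omega> i. T i \<omega>) \<Otimes>\<^sub>M distr M G (\<lambda>\<omega>. \<omega>)) = sets (?P \<Otimes>\<^sub>M G)"
        by (intro sets_pair_measure_cong sets_distr)
      then show "\<Phi> \<in> borel_measurable (distr M ?P (\<lambda>\<omega> i. T i \<omega>) \<Otimes>\<^sub>M distr M G (\<lambda>\<omega>. \<omega>))"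
        using \<Phi>m by (simp cong: measurable_cong_sets)
    qed (simp add: \<Phi>_def case_prod_unfold f)
    from DD.integral_fst'[OF this] show ?thesis unfolding joint by simp
  qed
  also have "\<dots> = (\<integral>\<tau>. \<integral>\<omega>. \<Phi> (\<tau>, \<omega>) \<partial>M \<partial>distr M ?P (\<lambda>\<omega> i. T i \<omega>))"
  proof -
    have "(\<integral>\<omega>. \<Phi> (\<tau>, \<omega>) \<partial>distr M G (\<lambda>\<omega>. \<omega>)) = (\<integral>\<omega>. \<Phi> (\<tau>, \<omega>) \<partial>M)" for \<tau>
      by (rule integral_distr[OF idm]) (rule measurable_compose[OF measurable_Pair1' \<Phi>m], simp add: space_PiM)
    then show ?thesis by simp
  qed
  also have "\<dots> = expectation (\<lambda>\<omega>'. \<integral>\<omega>. \<Phi> (\<lambda>i. T i \<omega>', \<omega>) \<partial>M)"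
  proof (rule integral_distr[OF Tm])
    have "\<Phi> \<in> borel_measurable (?P \<Otimes>\<^sub>M M)"
    proof -
      have "(\<lambda>x. (fst x, snd x)) \<in> measurable (?P \<Otimes>\<^sub>M M) (?P \<Otimes>\<^sub>M G)"
        by (intro measurable_Pair measurable_fst measurable_compose[OF measurable_snd idm])
      from measurable_compose[OF this \<Phi>m] show ?thesis by simp
    qed
    then show "(\<lambda>\<tau>. \<integral>\<omega>. \<Phi> (\<tau>, \<omega>) \<partial>M) \<in> borel_measurable ?P" by measurable
  qed
  also have "\<dots> = expectation (\<lambda>\<omega>'. expect_given_gaps f t (\<lambda>i. gap T i \<omega>'))"
    by (simp add: \<Phi>_def expect_given_gaps_def arrival_times_gap)
  also have "\<dots> = (\<integral>g. expect_given_gaps f t g \<partial>gaps_law)"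
    unfolding gaps_distr[symmetric]
  proof (rule integral_distr[symmetric])
    show "(\<lambda>\<omega> i. gap T i \<omega>) \<in> measurable M ?P" by (rule measurable_PiM_single') auto
    have "(\<lambda>x. queue_lengths (\<lambda>i _. arrival_times (fst x) i) S X t (snd x)) \<in> measurable (?P \<Otimes>\<^sub>M M) (count_space UNIV)"
      by (rule queue_lengths_measurable[OF batch_measurable jointly_measurable_locations]) auto
    from measurable_compose[OF this, of f borel]
    have "(\<lambda>(g, \<omega>). f (queue_lengths (\<lambda>i _. arrival_times g i) S X t \<omega>)) \<in> borel_measurable (?P \<Otimes>\<^sub>M M)" by (simp add: case_prod_unfold)
    then show "expect_given_gaps f t \<in> borel_measurable ?P"
      unfolding expect_given_gaps_def[abs_def] by measurable
  qed
  finally show ?thesis .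
qed

end

section \<open>The renewal equation\<close>

text \<open>
  Vectors of natural numbers form a countable discrete space, in which all sets are Borel sets and all
  functions are continuous.
\<close>

lemma open_nat_vec: "open (A :: (nat ^ 'j::finite) set)"
  unfolding open_vec_def
proof (intro ballI)
  fix x assume x: "x \<in> A"
  show "\<exists>U. (\<forall>i. open (U i) \<and> x $ i \<in> U i) \<and> (\<forall>y. (\<forall>i. y $ i \<in> U i) \<longrightarrow> y \<in> A)"
  proof (intro exI[of _ "\<lambda>i. {x $ i}"] conjI allI impI)
    fix y assume "\<forall>i. y $ i \<in> {x $ i}"
    then have "y = x" by (simp add: vec_eq_iff)
    then show "y \<in> A" using x by simp
  qed (simp_all add: discrete_topology_class.open_discrete)
qed

lemma sets_borel_nat_vec: "sets (borel :: (nat ^ 'j::finite) measure) = sets (count_space UNIV)"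
  using borel_open[OF open_nat_vec] by auto

lemma continuous_on_nat_vec: "continuous_on UNIV (f :: nat ^ 'j::finite \<Rightarrow> real)"
  by (simp add: continuous_on_open_vimage open_nat_vec)

context infinite_server_network
begin

lemma queue_lengths_random_variable: "queue_lengths T S X t \<in> measurable M (count_space UNIV)"
proof -
  have "(\<lambda>\<omega>. queue_lengths (\<lambda>i _. T i \<omega>) S X t \<omega>) \<in> measurable M (count_space UNIV)"
    by (rule queue_lengths_measurable[OF batch_measurable jointly_measurable_locations T_measurable]) auto
  also have "(\<lambda>\<omega>. queue_lengths (\<lambda>i _. T i \<omega>) S X t \<omega>) = queue_lengths T S X t"
    by (intro ext) (simp add: queue_lengths_def)
  finally show ?thesis .
qed

text \<open>
  By \<open>expectation_eq_gaps\<close> this is, for bounded \<open>f\<close>, the expectation of \<open>f\<close> of the queue lengths at time \<open>t\<close>.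
\<close>

definition mean_value :: "(nat ^ 'j \<Rightarrow> real) \<Rightarrow> real \<Rightarrow> real" where
  "mean_value f t = (\<integral>g. expect_given_gaps f t g \<partial>gaps_law)"

text \<open>
  The expectation of \<open>f\<close> of the queue lengths at time \<open>t\<close> if an additional batch arrives at time \<open>0\<close>.
\<close>

definition mean_value_extra :: "(nat ^ 'j \<Rightarrow> real) \<Rightarrow> real \<Rightarrow> real" where
  "mean_value_extra f t = (\<integral>g. expect_given_gaps f t (case_nat 0 g) \<partial>gaps_law)"

lemma expect_given_gaps_measurable:
  "(\<lambda>x. expect_given_gaps f (fst x) (snd x)) \<in> borel_measurable (borel \<Otimes>\<^sub>M (\<Pi>\<^sub>M i\<in>UNIV. borel))"
proof -
  let ?K = "borel \<Otimes>\<^sub>M (\<Pi>\<^sub>M i\<in>UNIV. borel) :: (real \<times> (nat \<Rightarrow> real)) measure"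
  have arr: "(\<lambda>x. arrival_times (snd (fst x)) i) \<in> borel_measurable (?K \<Otimes>\<^sub>M M)" for i
    by (rule measurable_compose[OF measurable_compose[OF measurable_fst measurable_snd] arrival_times_measurable])
  have "(\<lambda>x. queue_lengths (\<lambda>i _. arrival_times (snd (fst x)) i) S X (fst (fst x)) (snd x)) \<in> measurable (?K \<Otimes>\<^sub>M M) (count_space UNIV)"
    by (rule queue_lengths_measurable[OF batch_measurable jointly_measurable_locations arr]) auto
  from measurable_compose[OF this, of f borel]
  have "(\<lambda>(x, \<omega>). f (queue_lengths (\<lambda>i _. arrival_times (snd x) i) S X (fst x) \<omega>)) \<in> borel_measurable (?K \<Otimes>\<^sub>M M)"
    by (simp add: case_prod_unfold)
  then show ?thesis
    unfolding expect_given_gaps_def by (rule borel_measurable_lebesgue_integral)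
qed

lemma expect_given_gaps_bound:
  assumes f: "\<And>n. \<bar>f n\<bar> \<le> C"
  shows "\<bar>expect_given_gaps f t g\<bar> \<le> C"
proof -
  have "\<bar>expect_given_gaps f t g\<bar> \<le> expectation (\<lambda>\<omega>. \<bar>f (queue_lengths (\<lambda>i _. arrival_times g i) S X t \<omega>)\<bar>)"
    unfolding expect_given_gaps_def by (rule integral_abs_bound)
  also have "\<dots> \<le> C"
  proof (rule integral_le_const)
    have "(\<lambda>\<omega>. queue_lengths (\<lambda>i _. arrival_times g i) S X t \<omega>) \<in> measurable M (count_space UNIV)"
      by (rule queue_lengths_measurable[OF batch_measurable jointly_measurable_locations]) auto
    from integrable_bounded_fun[OF this, of f C] f
    show "integrable M (\<lambda>\<omega>. \<bar>f (queue_lengths (\<lambda>i _. arrival_times g i) S X t \<omega>)\<bar>)" by simp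
  qed (use f in auto)
  finally show ?thesis .
qed

lemma mean_value_measurable[measurable]:
  "mean_value f \<in> borel_measurable borel" "mean_value_extra f \<in> borel_measurable borel"
proof -
  interpret L: prob_space gaps_law by (rule gaps_law_prob_space)
  have cons: "(\<lambda>g. case_nat (0::real) g) \<in> measurable (\<Pi>\<^sub>M i\<in>UNIV. borel) (\<Pi>\<^sub>M i\<in>UNIV. borel)"
    by (rule measurable_case_nat') auto
  have eq: "sets (borel \<Otimes>\<^sub>M gaps_law) = sets (borel \<Otimes>\<^sub>M (\<Pi>\<^sub>M i\<in>UNIV. borel))"
    by (intro sets_pair_measure_cong refl gaps_law_sets)
  have "(\<lambda>(t, g). expect_given_gaps f t g) \<in> borel_measurable (borel \<Otimes>\<^sub>M gaps_law)"
    using expect_given_gaps_measurable[of f] unfolding measurable_cong_sets[OF eq refl] by (simp add: case_prod_unfold)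
  then show "mean_value f \<in> borel_measurable borel"
    unfolding mean_value_def[abs_def] by (rule L.borel_measurable_lebesgue_integral)
  have "(\<lambda>x. (fst x, case_nat (0::real) (snd x))) \<in> measurable (borel \<Otimes>\<^sub>M (\<Pi>\<^sub>M i\<in>UNIV. borel)) (borel \<Otimes>\<^sub>M (\<Pi>\<^sub>M i\<in>UNIV. borel))"
    by (rule measurable_Pair[OF measurable_fst measurable_compose[OF measurable_snd cons]])
  from measurable_compose[OF this expect_given_gaps_measurable[of f]]
  have "(\<lambda>(t, g). expect_given_gaps f t (case_nat 0 g)) \<in> borel_measurable (borel \<Otimes>\<^sub>M gaps_law)"
    unfolding measurable_cong_sets[OF eq refl] by (simp add: case_prod_unfold)
  then show "mean_value_extra f \<in> borel_measurable borel"
    unfolding mean_value_extra_def[abs_def] by (rule L.borel_measurable_lebesgue_integral)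
qed

lemma expect_given_gaps_integrable:
  assumes f: "\<And>n. \<bar>f n\<bar> \<le> C"
  shows "integrable gaps_law (expect_given_gaps f t)" "integrable gaps_law (\<lambda>g. expect_given_gaps f t (case_nat s g))"
proof -
  interpret L: prob_space gaps_law by (rule gaps_law_prob_space)
  have cons: "(\<lambda>g. case_nat s g) \<in> measurable (\<Pi>\<^sub>M i\<in>UNIV. borel) (\<Pi>\<^sub>M i\<in>UNIV. borel)"
    by (rule measurable_case_nat') auto
  have m: "expect_given_gaps f t \<in> borel_measurable (\<Pi>\<^sub>M i\<in>UNIV. borel)"
    using measurable_compose[OF measurable_Pair1'[of t] expect_given_gaps_measurable[of f]] by simp
  note [simp] = measurable_cong_sets[OF gaps_law_sets refl]
  show "integrable gaps_law (expect_given_gaps f t)"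
    by (rule L.integrable_const_bound[where B=C]) (use expect_given_gaps_bound[OF f] m in auto)
  show "integrable gaps_law (\<lambda>g. expect_given_gaps f t (case_nat s g))"
    by (rule L.integrable_const_bound[where B=C]) (use expect_given_gaps_bound[OF f] measurable_compose[OF cons m] in auto)
qed

lemma mean_value_bound:
  assumes f: "\<And>n. \<bar>f n\<bar> \<le> C"
  shows "\<bar>mean_value f t\<bar> \<le> C" "\<bar>mean_value_extra f t\<bar> \<le> C"
proof -
  interpret L: prob_space gaps_law by (rule gaps_law_prob_space)
  note b = expect_given_gaps_bound[of f, OF f]
  show "\<bar>mean_value f t\<bar> \<le> C"
    unfolding mean_value_def
    by (rule order_trans[OF integral_abs_bound L.integral_le_const])
       (use expect_given_gaps_integrable(1)[of f, OF f] b in auto)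
  show "\<bar>mean_value_extra f t\<bar> \<le> C"
    unfolding mean_value_extra_def
    by (rule order_trans[OF integral_abs_bound L.integral_le_const])
       (use expect_given_gaps_integrable(2)[of f, OF f] b in auto)
qed

text \<open>
  If the first batch arrives at time \<open>s \<le> t\<close>, the network at time \<open>t\<close> is a network at time \<open>t - s\<close> that has
  received a batch at time \<open>0\<close>; if it arrives later, the network is still empty.
\<close>

lemma expect_given_first_gap:
  "s \<le> t \<Longrightarrow> expect_given_gaps f t (case_nat s g) = expect_given_gaps f (t - s) (case_nat 0 g)"
  "s > t \<Longrightarrow> regular_gaps g \<Longrightarrow> expect_given_gaps f t (case_nat s g) = f 0"
proof -
  have shift: "arrival_times (case_nat s g) i = s + arrival_times (case_nat 0 g) i" for i
    by (cases i) (simp_all add: arrival_times_case_nat)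
  have e: "s + x \<le> t \<longleftrightarrow> x \<le> t - s" "t - (s + x) = t - s - x" for x by auto
  show "expect_given_gaps f t (case_nat s g) = expect_given_gaps f (t - s) (case_nat 0 g)"
    unfolding expect_given_gaps_def queue_lengths_def shift e ..
  assume "s > t" "regular_gaps g"
  have "arrival_times g i \<ge> 0" for i
    using \<open>regular_gaps g\<close> by (auto simp: arrival_times_def regular_gaps_def intro: sum_nonneg)
  then have late: "\<not> arrival_times (case_nat s g) i \<le> t" for i
    using \<open>s > t\<close> by (cases i) (auto simp: arrival_times_case_nat not_le intro!: order.strict_trans2[of t s] add_increasing2)
  have "{(i, j, l). arrival_times (case_nat s g) i \<le> t \<and> l < S i \<omega> $ j \<and>
      X i j l (t - arrival_times (case_nat s g) i) \<omega> = Some k} = {}" for \<omega> k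
    using late by auto
  then have "queue_lengths (\<lambda>i _. arrival_times (case_nat s g) i) S X t \<omega> = 0" for \<omega>
    by (simp only: queue_lengths_def card.empty vec_eq_iff zero_index vec_lambda_beta simp_thms)
  then show "expect_given_gaps f t (case_nat s g) = f 0"
    by (simp add: expect_given_gaps_def prob_space)
qed

text \<open>
  Decomposition at the first arrival. The first interarrival time is exponential, and the sequence of
  the remaining ones is independent of it with the law of the whole sequence.
\<close>

lemma renewal_equation:
  assumes f: "\<And>n. \<bar>f n\<bar> \<le> C" and t: "t \<ge> 0"
  shows "mean_value f t = exp (- rate * t) * f 0 + (LBINT u:{0..t}. rate * exp (- rate * (t - u)) * mean_value_extra f u)"
proof -
  interpret E: prob_space gap_law by (rule gap_law_prob_space)
  interpret L: prob_space gaps_law by (rule gaps_law_prob_space)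
  interpret seq: sequence_space gap_law by unfold_locales
  interpret EL: pair_prob_space gap_law gaps_law ..
  let ?P = "\<Pi>\<^sub>M i\<in>UNIV. borel :: real measure"
  have H: "expect_given_gaps f t \<in> borel_measurable ?P"
    using measurable_compose[OF measurable_Pair1'[of t] expect_given_gaps_measurable[of f]] by simp
  have H': "expect_given_gaps f t \<in> borel_measurable gaps_law"
    using H by (simp only: measurable_cong_sets[OF gaps_law_sets refl])
  have cons: "(\<lambda>(s, g). case_nat s g) \<in> measurable (gap_law \<Otimes>\<^sub>M gaps_law) gaps_law"
    unfolding gaps_law_def case_prod_unfold by (rule measurable_case_nat') auto
  have iter: "distr (gap_law \<Otimes>\<^sub>M gaps_law) gaps_law (\<lambda>(s, g). case_nat s g) = gaps_law"
    using seq.PiM_iter by (simp add: gaps_law_def)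
  have "mean_value f t = (\<integral>x. expect_given_gaps f t ((\<lambda>(s, g). case_nat s g) x) \<partial>(gap_law \<Otimes>\<^sub>M gaps_law))"
    unfolding mean_value_def by (subst (1) iter[symmetric]) (rule integral_distr[OF cons H'])
  also have "\<dots> = (\<integral>s. \<integral>g. expect_given_gaps f t (case_nat s g) \<partial>gaps_law \<partial>gap_law)"
  proof -
    have "integrable (gap_law \<Otimes>\<^sub>M gaps_law) (\<lambda>x. expect_given_gaps f t ((\<lambda>(s, g). case_nat s g) x))"
      by (rule EL.P.integrable_const_bound[where B=C])
         (use expect_given_gaps_bound[of f, OF f] measurable_compose[OF cons H'] in auto)
    from EL.integral_fst'[OF this] show ?thesis by simp
  qed
  also have "\<dots> = (\<integral>s. indicator {..t} s * mean_value_extra f (t - s) + f 0 * (1 - indicator {..t} s) \<partial>gap_law)"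
  proof (rule Bochner_Integration.integral_cong[OF refl])
    fix s
    show "(\<integral>g. expect_given_gaps f t (case_nat s g) \<partial>gaps_law) = indicator {..t} s * mean_value_extra f (t - s) + f 0 * (1 - indicator {..t} s)"
    proof (cases "s \<le> t")
      case True
      then show ?thesis
        unfolding mean_value_extra_def expect_given_first_gap(1)[of s t, OF True] by simp
    next
      case False
      have "(\<integral>g. expect_given_gaps f t (case_nat s g) \<partial>gaps_law) = (\<integral>g. f 0 \<partial>gaps_law)"
      proof (rule integral_cong_AE)
        show "(\<lambda>g. expect_given_gaps f t (case_nat s g)) \<in> borel_measurable gaps_law"
          using expect_given_gaps_integrable(2)[of f, OF f] by blast
        show "AE g in gaps_law. expect_given_gaps f t (case_nat s g) = f 0"
          using AE_regular_gaps by eventually_elim (use False in \<open>simp add: expect_given_first_gap(2)\<close>)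
      qed simp
      then show ?thesis using False by (simp add: L.prob_space)
    qed
  qed
  also have "\<dots> = (\<integral>s. indicator {..t} s * mean_value_extra f (t - s) \<partial>gap_law) + f 0 * (1 - measure gap_law {..t})"
  proof -
    have m1: "(\<lambda>s. indicator {..t} s * mean_value_extra f (t - s)) \<in> borel_measurable borel" by measurable
    have "integrable gap_law (\<lambda>s. indicator {..t} s * mean_value_extra f (t - s))"
    proof (rule E.integrable_const_bound[where B=C])
      show "AE s in gap_law. norm (indicator {..t} s * mean_value_extra f (t - s)) \<le> C"
      proof (rule AE_I2)
        fix s
        show "norm (indicator {..t} s * mean_value_extra f (t - s)) \<le> C"
          using mean_value_bound(2)[of f C "t - s", OF f] by (cases "s \<le> t") auto
      qed
      show "(\<lambda>s. indicator {..t} s * mean_value_extra f (t - s)) \<in> borel_measurable gap_law"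
        using m1 by (simp only: measurable_cong_sets[OF gap_law_sets refl])
    qed
    moreover have ind: "integrable gap_law (indicator {..t} :: real \<Rightarrow> real)"
      by (rule integrable_real_indicator) (auto simp: gap_law_sets E.emeasure_eq_measure)
    moreover have "(\<integral>s. f 0 * (1 - indicator {..t} s) \<partial>gap_law) = f 0 * (1 - measure gap_law {..t})"
    proof -
      have "space gap_law = UNIV" by (simp add: gap_law_def)
      then show ?thesis using ind E.prob_space by simp
    qed
    moreover have "integrable gap_law (\<lambda>s. f 0 * (1 - indicator {..t} s))"
      by (intro integrable_mult_right Bochner_Integration.integrable_diff E.integrable_const ind)
    ultimately show ?thesis
      by (simp only: Bochner_Integration.integral_add)
  qed
  also have "measure gap_law {..t} = 1 - exp (- rate * t)"
  proof -
    have "emeasure gap_law {..t} = ennreal (1 - exp (- rate * t))"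
      using emeasure_erlang_density[of rate 0 t] rate_pos t by (simp add: gap_law_def erlang_CDF_def)
    then show ?thesis using rate_pos t by (simp add: measure_def)
  qed
  also have "(\<integral>s. indicator {..t} s * mean_value_extra f (t - s) \<partial>gap_law)
      = (LBINT s. exponential_density rate s * (indicator {..t} s * mean_value_extra f (t - s)))"
    unfolding gap_law_def
    by (subst integral_density) (use exponential_density_nonneg[OF rate_pos] in auto)
  also have "\<dots> = (LBINT u. exponential_density rate (t - u) * (indicator {..t} (t - u) * mean_value_extra f (t - (t - u))))"
    by (subst lborel_integral_real_affine[of "-1" _ t]) auto
  also have "\<dots> = (LBINT u:{0..t}. rate * exp (- rate * (t - u)) * mean_value_extra f u)"
    unfolding set_lebesgue_integral_def
    by (rule Bochner_Integration.integral_cong) (auto simp: exponential_density_def indicator_def algebra_simps)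
  finally show ?thesis by (simp add: algebra_simps)
qed

text \<open>
  An integrated Kolmogorov equation: over time, the expectation changes at the rate of arrivals times
  the effect of one additional batch whose age equals the elapsed time.
\<close>

lemma mean_value_increment:
  assumes f: "\<And>n. \<bar>f n\<bar> \<le> C" and st: "0 \<le> s" "s \<le> t"
  shows "mean_value f t - mean_value f s = rate * (LBINT u:{s..t}. mean_value_extra f u - mean_value f u)"
  by (rule renewal_imp_integral_equation[OF rate_pos mean_value_measurable(2,1)
        mean_value_bound(2)[of f, OF f] mean_value_bound(1)[of f, OF f] renewal_equation[of f, OF f] st])

lemma mean_value_extra_diff:
  assumes f: "\<And>n. \<bar>f n\<bar> \<le> C" and u: "u \<ge> 0"
  shows "\<bar>mean_value_extra f u - mean_value f u\<bar> \<le> 2 * C * occupation u"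
proof -
  interpret L: prob_space gaps_law by (rule gaps_law_prob_space)
  note i = expect_given_gaps_integrable[of f, OF f]
  have "\<bar>mean_value_extra f u - mean_value f u\<bar> = \<bar>\<integral>g. expect_given_gaps f u (case_nat 0 g) - expect_given_gaps f u g \<partial>gaps_law\<bar>"
    using i by (simp add: mean_value_extra_def mean_value_def)
  also have "\<dots> \<le> (\<integral>g. \<bar>expect_given_gaps f u (case_nat 0 g) - expect_given_gaps f u g\<bar> \<partial>gaps_law)"
    by (rule integral_abs_bound)
  also have "\<dots> \<le> 2 * C * occupation u"
  proof (rule L.integral_le_const)
    show "AE g in gaps_law. \<bar>expect_given_gaps f u (case_nat 0 g) - expect_given_gaps f u g\<bar> \<le> 2 * C * occupation u"
      using AE_regular_gaps by eventually_elim (rule extra_batch_bounded[OF u regular_gaps_finite f])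
  qed (use i in auto)
  finally show ?thesis .
qed

lemma mean_value_extra_half_weight:
  assumes u: "u \<ge> 0"
  shows "mean_value_extra half_weight u \<le> (1 - occupation u / 2) * mean_value half_weight u"
proof -
  interpret L: prob_space gaps_law by (rule gaps_law_prob_space)
  have f: "\<bar>half_weight n\<bar> \<le> 1" for n using half_weight_bounds[of n] by simp
  note i = expect_given_gaps_integrable[of half_weight, OF f]
  have "mean_value_extra half_weight u \<le> (\<integral>g. (1 - occupation u / 2) * expect_given_gaps half_weight u g \<partial>gaps_law)"
    unfolding mean_value_extra_def
  proof (rule integral_mono_AE)
    show "AE g in gaps_law. expect_given_gaps half_weight u (case_nat 0 g) \<le> (1 - occupation u / 2) * expect_given_gaps half_weight u g"
      using AE_regular_gaps by eventually_elim (rule extra_batch_half_weight[OF u regular_gaps_finite])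
  qed (use i in auto)
  then show ?thesis by (simp add: mean_value_def)
qed

end

section \<open>The criterion\<close>

context infinite_server_network
begin

lemma occupation_bounds: "0 \<le> occupation u" "occupation u \<le> 1"
  by (auto simp: occupation_def)

text \<open>
  Negative ages are replaced by \<open>0\<close> here and below, as \<open>q\<close> is only specified at nonnegative ones.
\<close>

lemma in_network_prob_measurable: "(\<lambda>u. in_network_prob q j (max 0 u)) \<in> borel_measurable borel"
proof -
  have "(\<lambda>u::real. max 0 u) \<in> measurable borel (restrict_space borel {0..})"
    by (rule measurable_restrict_space2) auto
  from measurable_compose[OF this location_prob_measurable]
  show ?thesis unfolding in_network_prob_def by (intro borel_measurable_sum)
qed

lemma occupation_measurable[measurable]: "(\<lambda>u. occupation (max 0 u)) \<in> borel_measurable borel"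
proof -
  have "(\<lambda>u. 1 - (\<Prod>j\<in>UNIV. (1 - in_network_prob q j (max 0 u)) ^ (s $ j))) \<in> borel_measurable borel" for s :: "nat ^ 'j"
    by (intro borel_measurable_diff borel_measurable_prod borel_measurable_power borel_measurable_const in_network_prob_measurable)
  from measurable_pair_measure_pmf[of "\<lambda>s u. 1 - (\<Prod>j\<in>UNIV. (1 - in_network_prob q j (max 0 u)) ^ (s $ j))", OF this]
  have "(\<lambda>u. measure_pmf.expectation p (\<lambda>s. 1 - (\<Prod>j\<in>UNIV. (1 - in_network_prob q j (max 0 u)) ^ (s $ j)))) \<in> borel_measurable borel"
    by (rule measure_pmf.borel_measurable_lebesgue_integral)
  then show ?thesis by (simp add: occupation_eq)
qed

lemma occupation_finite_iff_log_moment: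
  assumes Theta: "\<And>j. \<exists>\<delta>>0. in_network_prob q j \<in> \<Theta>(\<lambda>\<tau>. exp (- \<delta> * \<tau>))"
  shows "(\<exists>\<tau>\<ge>0. (\<integral>\<^sup>+u\<in>{\<tau>..}. ennreal (occupation (max 0 u)) \<partial>lborel) < \<infinity>) \<longleftrightarrow>
    (\<integral>\<^sup>+ s. ennreal (ln (real (\<Sum>j\<in>UNIV. s $ j) + 1)) \<partial>measure_pmf p) < \<infinity>"
proof -
  have "(\<lambda>u. in_network_prob q j (max 0 u)) \<in> \<Theta>(g) \<longleftrightarrow> in_network_prob q j \<in> \<Theta>(g)" for j and g :: "real \<Rightarrow> real"
    by (rule landau_theta.in_cong) (auto intro: eventually_mono[OF eventually_ge_at_top[of 0]])
  then have "\<exists>\<delta>>0. (\<lambda>u. in_network_prob q j (max 0 u)) \<in> \<Theta>(\<lambda>\<tau>. exp (- \<delta> * \<tau>))" for j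
    using Theta[of j] by blast
  moreover have "0 \<le> in_network_prob q j (max 0 u) \<and> in_network_prob q j (max 0 u) \<le> 1" for j u
    using in_network_prob_bounds[of "max 0 u" j] by simp
  ultimately show ?thesis
    using occupation_integral_finite_iff_log_moment[of "\<lambda>j u. in_network_prob q j (max 0 u)" p] in_network_prob_measurable
    by (simp add: occupation_eq)
qed

text \<open>
  A bound on the total variation distance between the laws at the times \<open>s\<close> and \<open>t\<close>, since it is the same
  for all functions \<open>f\<close> that are bounded by \<open>1\<close>.
\<close>

lemma mean_value_increment_bound:
  assumes f: "\<And>n. \<bar>f n\<bar> \<le> 1" and st: "0 \<le> s" "s \<le> t"
  shows "\<bar>mean_value f t - mean_value f s\<bar> \<le> 2 * rate * (LBINT u:{s..t}. occupation (max 0 u))"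
proof -
  have occ: "set_integrable lborel {s..t} (\<lambda>u. occupation (max 0 u))"
    by (rule set_integrable_bounded_interval[where K=1]) (simp_all add: occupation_bounds)
  have "\<bar>mean_value_extra f u - mean_value f u\<bar> \<le> 2" for u
    using mean_value_bound[of f 1 u, OF f] by linarith
  then have d: "set_integrable lborel {s..t} (\<lambda>u. mean_value_extra f u - mean_value f u)"
    by (intro set_integrable_bounded_interval[where K=2]) auto
  have "\<bar>LBINT u:{s..t}. mean_value_extra f u - mean_value f u\<bar> \<le> (LBINT u:{s..t}. \<bar>mean_value_extra f u - mean_value f u\<bar>)"
    using set_integral_norm_bound[OF d] by simp
  also have "\<dots> \<le> (LBINT u:{s..t}. 2 * occupation (max 0 u))"
  proof (rule set_integral_mono)
    show "set_integrable lborel {s..t} (\<lambda>u. \<bar>mean_value_extra f u - mean_value f u\<bar>)"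
      using d by (rule set_integrable_abs)
    show "set_integrable lborel {s..t} (\<lambda>u. 2 * occupation (max 0 u))"
      using occ by simp
    show "\<bar>mean_value_extra f u - mean_value f u\<bar> \<le> 2 * occupation (max 0 u)" if "u \<in> {s..t}" for u
      using mean_value_extra_diff[of f 1 u, OF f] that st by simp
  qed
  finally have "\<bar>LBINT u:{s..t}. mean_value_extra f u - mean_value f u\<bar> \<le> 2 * (LBINT u:{s..t}. occupation (max 0 u))"
    by simp
  then have "rate * \<bar>LBINT u:{s..t}. mean_value_extra f u - mean_value f u\<bar> \<le> rate * (2 * (LBINT u:{s..t}. occupation (max 0 u)))"
    using rate_pos by (intro mult_left_mono) auto
  then show ?thesis
    unfolding mean_value_increment[of f 1, OF f st] using rate_pos by (simp add: abs_mult mult_ac)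
qed

text \<open>
  By the previous bound the laws of the queue lengths at all times after \<open>s\<close> are as close to the law at
  time \<open>s\<close> as the integral of \<open>occupation\<close> from \<open>s\<close> on is small.
\<close>

lemma ergodic_if_occupation_integrable:
  assumes \<tau>: "\<tau> \<ge> 0" "(\<integral>\<^sup>+u\<in>{\<tau>..}. ennreal (occupation (max 0 u)) \<partial>lborel) < \<infinity>"
  shows "ergodic M (queue_lengths T S X)"
proof -
  note N = queue_lengths_random_variable
  have "\<exists>\<mu>. measure_pmf \<mu> = distr M (count_space UNIV) (queue_lengths T S X t)" for t
    by (rule pmf_of_countable_prob_space) (auto intro: prob_space_distr N)
  then obtain \<mu> where \<mu>: "\<And>t. measure_pmf (\<mu> t) = distr M (count_space UNIV) (queue_lengths T S X t)"
    by metis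
  have E\<mu>: "measure_pmf.expectation (\<mu> t) f = expectation (\<lambda>\<omega>. f (queue_lengths T S X t \<omega>))" for t and f :: "nat ^ 'j \<Rightarrow> real"
    unfolding \<mu> by (rule integral_distr[OF N]) simp
  have mean: "measure_pmf.expectation (\<mu> t) f = mean_value f t" if "\<And>n. \<bar>f n\<bar> \<le> 1" for t f
    unfolding E\<mu> mean_value_def by (rule expectation_eq_gaps[OF that])
  have "\<exists>\<pi>. \<forall>f. (\<forall>x. \<bar>f x\<bar> \<le> (1::real)) \<longrightarrow>
      ((\<lambda>t. measure_pmf.expectation (\<mu> t) f) \<longlongrightarrow> measure_pmf.expectation \<pi> f) at_top"
  proof (rule pmf_limit_of_total_variation_Cauchy)
    fix \<epsilon> :: real assume "\<epsilon> > 0"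
    then have "\<epsilon> / (2 * rate) > 0" using rate_pos by simp
    from integral_tail_small[OF occupation_measurable occupation_bounds(1) \<tau>(2) this]
    obtain s where s: "s \<ge> \<tau>" "\<And>t. (LBINT u:{s..t}. occupation (max 0 u)) \<le> \<epsilon> / (2 * rate)" by blast
    show "\<exists>s. \<forall>t\<ge>s. \<forall>f. (\<forall>x. \<bar>f x\<bar> \<le> (1::real)) \<longrightarrow>
      \<bar>measure_pmf.expectation (\<mu> t) f - measure_pmf.expectation (\<mu> s) f\<bar> \<le> \<epsilon>"
    proof (intro exI[of _ s] allI impI)
      fix t and f :: "nat ^ 'j \<Rightarrow> real" assume t: "t \<ge> s" and "\<forall>x. \<bar>f x\<bar> \<le> 1"
      then have f: "\<bar>f n\<bar> \<le> 1" for n by blast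
      have "\<bar>mean_value f t - mean_value f s\<bar> \<le> 2 * rate * (LBINT u:{s..t}. occupation (max 0 u))"
        using \<tau>(1) s(1) t by (intro mean_value_increment_bound f) auto
      also have "\<dots> \<le> 2 * rate * (\<epsilon> / (2 * rate))" using s(2)[of t] rate_pos by (intro mult_left_mono) auto
      also have "\<dots> = \<epsilon>" using rate_pos by simp
      finally show "\<bar>measure_pmf.expectation (\<mu> t) f - measure_pmf.expectation (\<mu> s) f\<bar> \<le> \<epsilon>"
        unfolding mean[OF f] .
    qed
  qed
  then obtain \<pi> where \<pi>: "\<And>f :: nat ^ 'j \<Rightarrow> real. (\<And>x. \<bar>f x\<bar> \<le> 1) \<Longrightarrow>
      ((\<lambda>t. measure_pmf.expectation (\<mu> t) f) \<longlongrightarrow> measure_pmf.expectation \<pi> f) at_top"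
    by blast
  have "converges_weakly (\<lambda>t. distr M borel (queue_lengths T S X t)) (measure_pmf \<pi>) at_top"
    unfolding converges_weakly_def
  proof (intro allI impI)
    fix f :: "nat ^ 'j \<Rightarrow> real" assume "bounded (range f)"
    then obtain C where C: "C > 0" "\<And>x. \<bar>f x\<bar> \<le> C" unfolding bounded_pos by auto
    have N': "queue_lengths T S X t \<in> measurable M borel" for t
      using N by (simp only: measurable_cong_sets[OF refl sets_borel_nat_vec])
    have fm: "f \<in> borel_measurable borel"
      by (simp only: measurable_cong_sets[OF sets_borel_nat_vec refl]) simp
    have "integral\<^sup>L (distr M borel (queue_lengths T S X t)) f = C * measure_pmf.expectation (\<mu> t) (\<lambda>x. f x / C)" for t
      using C(1) by (subst integral_distr[OF N' fm]) (simp add: E\<mu>)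
    moreover have "((\<lambda>t. C * measure_pmf.expectation (\<mu> t) (\<lambda>x. f x / C)) \<longlongrightarrow> C * measure_pmf.expectation \<pi> (\<lambda>x. f x / C)) at_top"
      using C by (intro tendsto_mult_left \<pi>) (simp add: divide_le_eq)
    ultimately show "((\<lambda>t. integral\<^sup>L (distr M borel (queue_lengths T S X t)) f) \<longlongrightarrow> integral\<^sup>L (measure_pmf \<pi>) f) at_top"
      using C(1) by simp
  qed
  then show ?thesis
    unfolding ergodic_def using sets_borel_nat_vec measure_pmf.prob_space_axioms
    by (intro exI[of _ "measure_pmf \<pi>"]) auto
qed

text \<open>
  The expectation of \<open>half_weight\<close> converges to its integral \<open>L\<close> over the limit law, which is positive
  because \<open>half_weight\<close> is. So it stays above \<open>L / 2\<close> from some time \<open>s\<close> on, and from then on it decreases at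
  a rate of at least \<open>rate * occupation u * L / 4\<close>. As it remains in the unit interval, the integral of
  this rate is at most \<open>1\<close>.
\<close>

lemma occupation_integrable_if_ergodic:
  assumes "ergodic M (queue_lengths T S X)"
  shows "\<exists>\<tau>\<ge>0. (\<integral>\<^sup>+u\<in>{\<tau>..}. ennreal (occupation (max 0 u)) \<partial>lborel) < \<infinity>"
proof -
  obtain \<pi> where \<pi>: "prob_space \<pi>" "sets \<pi> = sets borel"
    and conv: "converges_weakly (\<lambda>t. distr M borel (queue_lengths T S X t)) \<pi> at_top"
    using assms unfolding ergodic_def by blast
  interpret \<pi>: prob_space \<pi> by fact
  have hm: "half_weight \<in> borel_measurable borel"
    by (simp only: measurable_cong_sets[OF sets_borel_nat_vec refl]) simp
  have hb: "\<bar>half_weight n\<bar> \<le> 1" for n using half_weight_bounds[of n] by simp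
  have hi: "integrable \<pi> half_weight"
    by (rule \<pi>.integrable_const_bound[where B=1]) (use hb hm in \<open>auto simp: measurable_cong_sets[OF \<pi>(2) refl]\<close>)
  define L where "L = integral\<^sup>L \<pi> half_weight"
  have "L \<noteq> 0"
  proof
    assume "L = 0"
    then have "AE n in \<pi>. half_weight n = 0"
      using integral_nonneg_eq_0_iff_AE[OF hi] half_weight_bounds(1) by (auto simp: L_def intro: less_imp_le)
    moreover have "half_weight n \<noteq> 0" for n using half_weight_bounds(1)[of n] by simp
    ultimately show False by simp
  qed
  moreover have "L \<ge> 0" unfolding L_def by (rule integral_nonneg_AE) (auto intro: less_imp_le half_weight_bounds)
  ultimately have L: "L > 0" by simp
  have N': "queue_lengths T S X t \<in> measurable M borel" for t
    using queue_lengths_random_variable by (simp only: measurable_cong_sets[OF refl sets_borel_nat_vec])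
  have "integral\<^sup>L (distr M borel (queue_lengths T S X t)) half_weight = mean_value half_weight t" for t
    by (subst integral_distr[OF N' hm]) (simp add: mean_value_def expectation_eq_gaps[of half_weight, OF hb])
  moreover have "bounded (range half_weight)" using hb by (auto simp: bounded_iff)
  moreover have "((\<lambda>t. integral\<^sup>L (distr M borel (queue_lengths T S X t)) half_weight) \<longlongrightarrow> L) at_top"
    if "bounded (range half_weight)"
    using conv continuous_on_nat_vec that unfolding converges_weakly_def L_def by blast
  ultimately have "(mean_value half_weight \<longlongrightarrow> L) at_top" by simp
  then have "\<forall>\<^sub>F t in at_top. mean_value half_weight t > L / 2"
    using L by (intro order_tendstoD(1)) auto
  then obtain s0 where s0: "\<And>t. t \<ge> s0 \<Longrightarrow> mean_value half_weight t > L / 2"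
    unfolding eventually_at_top_linorder by blast
  define s where "s = max 0 s0"
  have s: "s \<ge> 0" by (simp add: s_def)
  have low: "mean_value half_weight t \<ge> L / 2" if "t \<ge> s" for t using s0[of t] that by (simp add: s_def)
  have bound: "(LBINT u:{s..t}. occupation (max 0 u)) \<le> 4 / (rate * L)" if t: "t \<ge> s" for t
  proof -
    have occ: "set_integrable lborel {s..t} (\<lambda>u. occupation (max 0 u))"
      by (rule set_integrable_bounded_interval[where K=1]) (simp_all add: occupation_bounds)
    have "\<bar>mean_value_extra half_weight u - mean_value half_weight u\<bar> \<le> 2" for u
      using mean_value_bound[of half_weight 1 u, OF hb] by linarith
    then have d: "set_integrable lborel {s..t} (\<lambda>u. mean_value_extra half_weight u - mean_value half_weight u)"
      by (intro set_integrable_bounded_interval[where K=2]) auto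
    have "(LBINT u:{s..t}. mean_value_extra half_weight u - mean_value half_weight u) \<le> (LBINT u:{s..t}. - (L / 4) * occupation (max 0 u))"
    proof (rule set_integral_mono[OF d])
      show "set_integrable lborel {s..t} (\<lambda>u. - (L / 4) * occupation (max 0 u))"
        by (rule set_integrable_mult_right) (rule occ)
      fix u assume u: "u \<in> {s..t}"
      have "occupation u * (L / 2) \<le> occupation u * mean_value half_weight u"
        using low[of u] u occupation_bounds by (intro mult_left_mono) auto
      then show "mean_value_extra half_weight u - mean_value half_weight u \<le> - (L / 4) * occupation (max 0 u)"
        using mean_value_extra_half_weight[of u] u s by (simp add: algebra_simps)
    qed
    then have "rate * (LBINT u:{s..t}. mean_value_extra half_weight u - mean_value half_weight u)
        \<le> rate * (- (L / 4) * (LBINT u:{s..t}. occupation (max 0 u)))"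
      unfolding set_integral_mult_right using rate_pos by (intro mult_left_mono) auto
    moreover have "mean_value half_weight t - mean_value half_weight s \<ge> - 1"
      using mean_value_bound(1)[of half_weight 1 s, OF hb] low[OF t] L by linarith
    ultimately have "rate * L / 4 * (LBINT u:{s..t}. occupation (max 0 u)) \<le> 1"
      unfolding mean_value_increment[of half_weight 1, OF hb s t] by simp
    then show ?thesis using rate_pos L by (simp add: field_simps)
  qed
  have "(\<integral>\<^sup>+u\<in>{s..}. ennreal (occupation (max 0 u)) \<partial>lborel) \<le> ennreal (4 / (rate * L))"
    by (rule nn_integral_bounded_by_intervals[OF occupation_measurable _ bound]) (use occupation_bounds in auto)
  also have "\<dots> < \<infinity>" by simp
  finally show ?thesis using s by blast
qed

end

theorem corollary4p1p3:
  fixes M :: "'a measure"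
    and rate :: real
    and T :: "nat \<Rightarrow> 'a \<Rightarrow> real"
    and p :: "(nat ^ 'j::finite) pmf"
    and S :: "nat \<Rightarrow> 'a \<Rightarrow> nat ^ 'j"
    and X :: "nat \<Rightarrow> 'j \<Rightarrow> nat \<Rightarrow> real \<Rightarrow> 'a \<Rightarrow> 'j option"
    and q :: "'j \<Rightarrow> 'j \<Rightarrow> real \<Rightarrow> real"
  assumes "infinite_server_network M rate T p S X q"
    and "\<And>j. \<exists>\<delta>>0. in_network_prob q j \<in> \<Theta>(\<lambda>\<tau>. exp (- \<delta> * \<tau>))"
  shows "ergodic M (queue_lengths T S X) \<longleftrightarrow>
    (\<integral>\<^sup>+ s. ennreal (ln (real (\<Sum>j\<in>UNIV. s $ j) + 1)) \<partial>measure_pmf p) < \<infinity>"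
proof -
  interpret infinite_server_network M rate T p S X q by fact
  have "ergodic M (queue_lengths T S X) \<longleftrightarrow>
      (\<exists>\<tau>\<ge>0. (\<integral>\<^sup>+u\<in>{\<tau>..}. ennreal (occupation (max 0 u)) \<partial>lborel) < \<infinity>)"
    using ergodic_if_occupation_integrable occupation_integrable_if_ergodic by blast
  then show ?thesis
    unfolding occupation_finite_iff_log_moment[OF assms(2)] .
qed

end
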